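(* Let $K$ be an infinite field and $n\ge 1$ an integer. If a multilinear polynomial $p\in K\langle x_1,\dots,x_m\rangle$ evaluated on $n\times n$ matrices over $K$ is $\nu$-central with $\nu>1$, then $\nu=n$.
   Context: $K\langle x_1,\dots,x_m\rangle$ is the free associative algebra in noncommuting variables. A polynomial is multilinear if it is a $K$-linear combination of monomials $x_{\pi(1)}\cdots x_{\pi(m)}$ with $\pi\in S_m$. A polynomial is central for $M_n(K)$ if it takes on only scalar values on $M_n(K)$ but does not vanish identically. A polynomial $p$ is $\nu$-central if $p^\nu$ is central, with $\nu\ge 1$ minimal such. *)

theory Defs
  imports "Jordan_Normal_Form.Matrix" "HOL-Library.Poly_Mapping" "HOL-Combinatorics.Permutations"
begin

text \<open>
  Noncommutative monomials are words over the variables, multiplied by concatenation. Since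
  Poly_Mapping derives convolution from an additive monoid of exponents, the free monoid is
  written additively, on a copy of the list type. The type \<open>(nat ncword, 'a) poly_mapping\<close>
  then is the free associative algebra in the noncommuting variables \<open>x\<^sub>0, x\<^sub>1, x\<^sub>2, \<dots>\<close>,
  and its \<open>*\<close> and \<open>^\<close> are those of the free algebra.
\<close>

datatype 'v ncword = NCWord (letters: "'v list")

instantiation ncword :: (type) monoid_add
begin

definition zero_ncword :: "'a ncword" where
  "zero_ncword = NCWord []"

definition plus_ncword :: "'a ncword \<Rightarrow> 'a ncword \<Rightarrow> 'a ncword" where
  "plus_ncword u v = NCWord (letters u @ letters v)"

instance
  by standard (simp_all add: zero_ncword_def plus_ncword_def)

end

type_synonym 'a ncpoly = "(nat ncword, 'a) poly_mapping"

text \<open>A multilinear polynomial involves only \<open>x\<^sub>1, \<dots>, x\<^sub>m\<close>, so it lies in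
  \<open>K\<langle>x\<^sub>1, \<dots>, x\<^sub>m\<rangle>\<close>.\<close>

definition multilinear :: "nat \<Rightarrow> 'a::zero ncpoly \<Rightarrow> bool" where
  "multilinear m p \<longleftrightarrow>
     (\<forall>w \<in> Poly_Mapping.keys p. \<exists>\<pi>. \<pi> permutes {1..m} \<and> w = NCWord (map \<pi> [1..<Suc m]))"

definition word_eval :: "nat \<Rightarrow> (nat \<Rightarrow> 'a::semiring_1 mat) \<Rightarrow> nat ncword \<Rightarrow> 'a mat" where
  "word_eval n X w = foldr (*) (map X (letters w)) (1\<^sub>m n)"

definition ncpoly_eval :: "nat \<Rightarrow> (nat \<Rightarrow> 'a::comm_ring_1 mat) \<Rightarrow> 'a ncpoly \<Rightarrow> 'a mat" where
  "ncpoly_eval n X p =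
     (\<Oplus>\<^bsub>module_mat TYPE('a) n n\<^esub>w\<in>Poly_Mapping.keys p. Poly_Mapping.lookup p w \<cdot>\<^sub>m word_eval n X w)"

text \<open>All variables receive a matrix; the value depends only on those occurring in \<open>p\<close>.\<close>

definition central_poly :: "nat \<Rightarrow> 'a::comm_ring_1 ncpoly \<Rightarrow> bool" where
  "central_poly n p \<longleftrightarrow>
     (\<forall>X. (\<forall>i. X i \<in> carrier_mat n n) \<longrightarrow> (\<exists>c. ncpoly_eval n X p = c \<cdot>\<^sub>m 1\<^sub>m n)) \<and>
     (\<exists>X. (\<forall>i. X i \<in> carrier_mat n n) \<and> ncpoly_eval n X p \<noteq> 0\<^sub>m n n)"

definition nu_central :: "nat \<Rightarrow> nat \<Rightarrow> 'a::comm_ring_1 ncpoly \<Rightarrow> bool" where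
  "nu_central n \<nu> p \<longleftrightarrow>
     \<nu> \<ge> 1 \<and> central_poly n (p ^ \<nu>) \<and> (\<forall>k. 1 \<le> k \<and> k < \<nu> \<longrightarrow> \<not> central_poly n (p ^ k))"

end

theory Submission
  imports
    "HOL-Algebra.Algebraic_Closure_Type"
    Defs
    "Jordan_Normal_Form.Char_Poly"
begin

text \<open>
  Let \<open>p\<close> be \<open>\<nu>\<close>-central with \<open>\<nu> > 1\<close>; then
  \<open>p\<close> itself has a non-scalar value. Two things have to be seen: \<open>n\<close>
  divides \<open>\<nu>\<close>, and \<open>p ^ n\<close> is already central.

  Divisibility comes from a single good value. The values of \<open>p\<close> are closed under
  conjugation, so a non-scalar value can be replaced by one whose entry at \<open>(0,1)\<close>
  does not vanish. That entry is linear in each argument, so every argument may be replaced by a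
  multiple of a matrix unit without killing it. Now grade the matrix algebra by
  \<open>\<int>/n\<close>, where the unit at \<open>(a,b)\<close> has degree \<open>b - a\<close>.
  All monomials of \<open>p\<close> use the same arguments, so homogeneous arguments give a
  homogeneous value, here of degree \<open>1\<close>. Keep the degrees of the arguments fixed and
  let their entries vary: each entry \<open>(a, a+1)\<close> of the value is a polynomial function
  of them. It is not the zero function, because cyclically renumbering the basis respects the
  degrees and moves the entry \<open>(0,1)\<close> to \<open>(a, a+1)\<close>. Over an infinite
  field these \<open>n\<close> functions have a common nonzero point
  (\<open>poly_on_lines_nonzero_common\<close>). So \<open>p\<close> takes a value
  \<open>A\<close> whose nonzero entries are exactly those at \<open>(a, a+1)\<close>, a weighted
  \<open>n\<close>-cycle (\<open>exists_weighted_cycle_value\<close>). The power \<open>A ^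
  k\<close> is homogeneous of degree \<open>k\<close> with no zero weight, so it can be scalar
  only if \<open>n\<close> divides \<open>k\<close>.

  For the centrality of \<open>p ^ n\<close>, consider a value \<open>P\<close> with \<open>P ^
  \<nu> = s\<close> scalar. Its eigenvalues in an algebraic closure differ from one another by
  \<open>\<nu>\<close>-th roots of unity. Hence for the coefficient \<open>\<alpha>\<close> of
  \<open>x ^ j\<close> in the characteristic polynomial, \<open>\<alpha> ^ \<nu> * s ^ j = v * s ^
  n\<close> with \<open>v\<close> from a finite set that does not depend on \<open>P\<close>
  (\<open>char_poly_coeff_of_scalar_pow\<close>). Polynomial functions over an infinite field have
  no zero divisors, so one \<open>v\<close> serves for all values. At the weighted cycle
  \<open>A\<close> the middle coefficients vanish while \<open>s\<close> does not; thus \<open>v =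
  0\<close>, and the middle coefficients vanish at every value of \<open>p\<close>. The
  characteristic polynomial of every value is therefore \<open>x ^ n - d\<close>, and the
  Cayley-Hamilton argument gives \<open>P ^ n = d\<close>
  (\<open>pow_eq_scalar_of_char_poly\<close>).
\<close>

section \<open>Evaluation is an algebra homomorphism\<close>

lemma word_eval_carrier:
  assumes "\<forall>i. Y i \<in> carrier_mat n n"
  shows "word_eval n Y w \<in> carrier_mat n n"
proof -
  have "foldr (*) (map Y xs) (1\<^sub>m n) \<in> carrier_mat n n" for xs
    by (induction xs) (auto intro: mult_carrier_mat assms[rule_format])
  then show ?thesis by (simp add: word_eval_def)
qed

lemma word_eval_zero: "word_eval n Y 0 = 1\<^sub>m n"
  by (simp add: word_eval_def zero_ncword_def)

lemma word_eval_Cons: "word_eval n Y (NCWord (x # xs)) = Y x * word_eval n Y (NCWord xs)"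
  by (simp add: word_eval_def)

lemma word_eval_add:
  assumes Y: "\<forall>i. Y i \<in> carrier_mat n n"
  shows "word_eval n Y (u + v) = word_eval n Y u * word_eval n Y v"
proof -
  have "word_eval n Y (NCWord (xs @ letters v)) = word_eval n Y (NCWord xs) * word_eval n Y v" for xs
  proof (induction xs)
    case Nil
    then show ?case
      using left_mult_one_mat[OF word_eval_carrier[OF Y, of v]] by (simp add: word_eval_def)
  next
    case (Cons x xs)
    then show ?case
      using assoc_mult_mat[OF spec[OF Y, of x] word_eval_carrier[OF Y, of "NCWord xs"] word_eval_carrier[OF Y, of v]]
      by (simp add: word_eval_Cons)
  qed
  from this[of "letters u"] show ?thesis
    by (simp add: plus_ncword_def)
qed

text \<open>
  The evaluation is defined as an abstract sum in the module of matrices; everything below works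
  with its entries, which are ordinary sums over the ground ring.
\<close>
lemma finsum_word_eval:
  assumes Y: "\<forall>i. Y i \<in> carrier_mat n n" and "finite S"
  shows "(\<Oplus>\<^bsub>module_mat TYPE('a::comm_ring_1) n n\<^esub>w\<in>S. f w \<cdot>\<^sub>m word_eval n Y w) \<in> carrier_mat n n"
    and "i < n \<Longrightarrow> j < n \<Longrightarrow>
      (\<Oplus>\<^bsub>module_mat TYPE('a) n n\<^esub>w\<in>S. f w \<cdot>\<^sub>m word_eval n Y w) $$ (i,j)
        = (\<Sum>w\<in>S. f w * word_eval n Y w $$ (i,j))"
proof -
  interpret M: abelian_group "module_mat TYPE('a) n n" by (rule abelian_group_mat)
  note W = word_eval_carrier[OF Y]
  have C: "(\<lambda>w. f w \<cdot>\<^sub>m word_eval n Y w) \<in> T \<rightarrow> carrier (module_mat TYPE('a) n n)" for T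
    using W by (auto simp: module_mat_simps)
  show "(\<Oplus>\<^bsub>module_mat TYPE('a::comm_ring_1) n n\<^esub>w\<in>S. f w \<cdot>\<^sub>m word_eval n Y w) \<in> carrier_mat n n"
    using M.finsum_closed[OF C] by (simp add: module_mat_simps)
  assume ij: "i < n" "j < n"
  from \<open>finite S\<close> show "(\<Oplus>\<^bsub>module_mat TYPE('a) n n\<^esub>w\<in>S. f w \<cdot>\<^sub>m word_eval n Y w) $$ (i,j)
        = (\<Sum>w\<in>S. f w * word_eval n Y w $$ (i,j))"
  proof (induction S rule: finite_induct)
    case empty
    then show ?case using ij M.finsum_empty by (simp add: module_mat_simps)
  next
    case (insert w S)
    have "dim_row (word_eval n Y w) = n" "dim_col (word_eval n Y w) = n" using W by auto
    moreover have "(\<Oplus>\<^bsub>module_mat TYPE('a::comm_ring_1) n n\<^esub>w\<in>S. f w \<cdot>\<^sub>m word_eval n Y w) \<in> carrier_mat n n"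
      using M.finsum_closed[OF C] by (simp add: module_mat_simps)
    ultimately show ?case
      using insert ij M.finsum_insert[OF insert(1,2) C] W[of w]
      by (simp add: module_mat_simps)
  qed
qed

lemma ncpoly_eval_carrier:
  assumes "\<forall>i. Y i \<in> carrier_mat n n"
  shows "ncpoly_eval n Y p \<in> carrier_mat n n"
  unfolding ncpoly_eval_def by (rule finsum_word_eval[OF assms]) auto

lemma ncpoly_eval_entry:
  assumes "\<forall>i. Y i \<in> carrier_mat n n" and "i < n" "j < n"
  shows "ncpoly_eval n Y p $$ (i,j) = (\<Sum>w\<in>Poly_Mapping.keys p. Poly_Mapping.lookup p w * word_eval n Y w $$ (i,j))"
  unfolding ncpoly_eval_def by (rule finsum_word_eval(2)[OF assms(1) _ assms(2,3)]) auto

lemma ncpoly_eval_add: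
  assumes Y: "\<forall>i. Y i \<in> carrier_mat n n"
  shows "ncpoly_eval n Y (p + q) = ncpoly_eval n Y p + ncpoly_eval n Y q"
proof (rule eq_matI)
  note C = ncpoly_eval_carrier[OF Y]
  show "dim_row (ncpoly_eval n Y (p + q)) = dim_row (ncpoly_eval n Y p + ncpoly_eval n Y q)"
    "dim_col (ncpoly_eval n Y (p + q)) = dim_col (ncpoly_eval n Y p + ncpoly_eval n Y q)"
    using C[of p] C[of q] C[of "p+q"] by auto
  fix i j assume "i < dim_row (ncpoly_eval n Y p + ncpoly_eval n Y q)"
     "j < dim_col (ncpoly_eval n Y p + ncpoly_eval n Y q)"
  then have ij: "i < n" "j < n" using C[of q] by auto
  have ext: "ncpoly_eval n Y r $$ (i,j) =
      (\<Sum>w\<in>Poly_Mapping.keys p \<union> Poly_Mapping.keys q. Poly_Mapping.lookup r w * word_eval n Y w $$ (i,j))"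
    if "Poly_Mapping.keys r \<subseteq> Poly_Mapping.keys p \<union> Poly_Mapping.keys q" for r
    unfolding ncpoly_eval_entry[OF Y ij] using that
    by (intro sum.mono_neutral_left) (auto simp: in_keys_iff)
  show "ncpoly_eval n Y (p + q) $$ (i,j) = (ncpoly_eval n Y p + ncpoly_eval n Y q) $$ (i,j)"
    using ij C[of p] C[of q] Poly_Mapping.keys_add[of p q]
    by (auto simp: ext lookup_add algebra_simps sum.distrib)
qed

lemma ncpoly_eval_single:
  assumes Y: "\<forall>i. Y i \<in> carrier_mat n n"
  shows "ncpoly_eval n Y (Poly_Mapping.single w c) = c \<cdot>\<^sub>m word_eval n Y w"
proof (rule eq_matI)
  note C = ncpoly_eval_carrier[OF Y, of "Poly_Mapping.single w c"] word_eval_carrier[OF Y, of w]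
  then show "dim_row (ncpoly_eval n Y (Poly_Mapping.single w c)) = dim_row (c \<cdot>\<^sub>m word_eval n Y w)"
    "dim_col (ncpoly_eval n Y (Poly_Mapping.single w c)) = dim_col (c \<cdot>\<^sub>m word_eval n Y w)" by auto
  fix i j assume "i < dim_row (c \<cdot>\<^sub>m word_eval n Y w)" "j < dim_col (c \<cdot>\<^sub>m word_eval n Y w)"
  then have "i < n" "j < n" using C by auto
  then show "ncpoly_eval n Y (Poly_Mapping.single w c) $$ (i, j) = (c \<cdot>\<^sub>m word_eval n Y w) $$ (i, j)"
    using C by (simp add: ncpoly_eval_entry[OF Y])
qed

text \<open>
  Monomials span the free algebra, so facts that are additive in the polynomial need only be
  checked on a single monomial.
\<close>
lemma poly_mapping_add_induct [case_names single add]: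
  fixes p :: "('b, 'a::comm_monoid_add) poly_mapping"
  assumes single: "\<And>w c. P (Poly_Mapping.single w c)"
    and add: "\<And>p q. P p \<Longrightarrow> P q \<Longrightarrow> P (p + q)"
  shows "P p"
proof (induction p rule: update_induct)
  case const
  then show ?case using single[of undefined 0] by simp
next
  case (update f a b)
  have "Poly_Mapping.update a b f = Poly_Mapping.single a b + f"
    using update(1) by (intro poly_mapping_eqI) (auto simp: lookup_update lookup_add lookup_single in_keys_iff when_def)
  then show ?case using single add update by simp
qed

lemma ncpoly_eval_mult:
  assumes Y: "\<forall>i. Y i \<in> carrier_mat n n"
  shows "ncpoly_eval n Y (p * q) = ncpoly_eval n Y p * ncpoly_eval n Y q"
proof (induction p rule: poly_mapping_add_induct)
  case (single u a)
  note C = ncpoly_eval_carrier[OF Y] word_eval_carrier[OF Y]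
  show ?case
  proof (induction q rule: poly_mapping_add_induct)
    case (single v b)
    show ?case
      by (rule eq_matI; insert C(2)[of u] C(2)[of v])
        (auto simp: mult_single ncpoly_eval_single[OF Y] word_eval_add[OF Y])
  next
    case (add p q)
    then show ?case
      using mult_add_distrib_mat[OF C(1)[of "Poly_Mapping.single u a"] C(1)[of p] C(1)[of q]]
      by (simp add: ncpoly_eval_add[OF Y] distrib_left)
  qed
next
  case (add r s)
  note C = ncpoly_eval_carrier[OF Y]
  from add show ?case
    using add_mult_distrib_mat[OF C[of r] C[of s] C[of q]]
    by (simp add: ncpoly_eval_add[OF Y] distrib_right)
qed

lemma ncpoly_eval_power:
  assumes Y: "\<forall>i. Y i \<in> carrier_mat n n"
  shows "ncpoly_eval n Y (p ^ k) = ncpoly_eval n Y p ^\<^sub>m k"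
proof (induction k)
  case 0
  have "ncpoly_eval n Y 1 = 1\<^sub>m n"
    unfolding single_one[symmetric] ncpoly_eval_single[OF Y] by (auto simp: word_eval_zero)
  then show ?case using ncpoly_eval_carrier[OF Y, of p] by auto
next
  case (Suc k)
  then show ?case by (simp only: power_Suc2 ncpoly_eval_mult[OF Y] pow_mat.simps)
qed

section \<open>Evaluation commutes with endomorphisms of the matrix algebra\<close>

text \<open>
  The two instances used are conjugation by a transvection and a renumbering of the basis. They
  are treated alike because only compatibility with the algebra operations matters for the values
  of a polynomial.
\<close>
definition mat_alg_endo :: "nat \<Rightarrow> ('a::comm_ring_1 mat \<Rightarrow> 'a mat) \<Rightarrow> bool" where
  "mat_alg_endo n \<phi> \<longleftrightarrow>
     (\<forall>A \<in> carrier_mat n n. \<phi> A \<in> carrier_mat n n) \<and> \<phi> (1\<^sub>m n) = 1\<^sub>m n \<and>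
     (\<forall>A \<in> carrier_mat n n. \<forall>B \<in> carrier_mat n n. \<phi> (A * B) = \<phi> A * \<phi> B \<and> \<phi> (A + B) = \<phi> A + \<phi> B) \<and>
     (\<forall>c. \<forall>A \<in> carrier_mat n n. \<phi> (c \<cdot>\<^sub>m A) = c \<cdot>\<^sub>m \<phi> A)"

text \<open>
  This is what makes the set of values of a polynomial invariant under conjugation.
\<close>
lemma ncpoly_eval_endo:
  assumes Y: "\<forall>i. Y i \<in> carrier_mat n n" and \<phi>: "mat_alg_endo n \<phi>"
  shows "ncpoly_eval n (\<lambda>i. \<phi> (Y i)) p = \<phi> (ncpoly_eval n Y p)"
proof -
  have Y': "\<forall>i. \<phi> (Y i) \<in> carrier_mat n n"
    using Y \<phi> by (auto simp: mat_alg_endo_def)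
  have W: "word_eval n (\<lambda>i. \<phi> (Y i)) (NCWord xs) = \<phi> (word_eval n Y (NCWord xs))" for xs
  proof (induction xs)
    case Nil
    then show ?case using \<phi> by (simp add: word_eval_def mat_alg_endo_def)
  next
    case (Cons x xs)
    then show ?case
      using \<phi> spec[OF Y, of x] word_eval_carrier[OF Y, of "NCWord xs"]
      by (simp add: word_eval_Cons mat_alg_endo_def)
  qed
  show ?thesis
  proof (induction p rule: poly_mapping_add_induct)
    case (single w c)
    then show ?case
      using \<phi> W[of "letters w"] word_eval_carrier[OF Y, of w]
      by (simp add: ncpoly_eval_single[OF Y] ncpoly_eval_single[OF Y'] mat_alg_endo_def)
  next
    case (add p q)
    then show ?case
      using \<phi> ncpoly_eval_carrier[OF Y]
      by (simp add: ncpoly_eval_add[OF Y] ncpoly_eval_add[OF Y'] mat_alg_endo_def)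
  qed
qed

lemma mat_alg_endo_conj:
  fixes G H :: "'a::comm_ring_1 mat"
  assumes G: "G \<in> carrier_mat n n" and H: "H \<in> carrier_mat n n"
    and GH: "G * H = 1\<^sub>m n" and HG: "H * G = 1\<^sub>m n"
  shows "mat_alg_endo n (\<lambda>A. G * A * H)"
proof -
  have "G * (A * B) * H = (G * A * H) * (G * B * H)"
    if A: "A \<in> carrier_mat n n" and B: "B \<in> carrier_mat n n" for A B
  proof -
    have "(G * A * H) * (G * B * H) = G * A * (H * G) * B * H"
      using A B G H by (simp add: assoc_mult_mat[of _ n n _ n _ n] mult_carrier_mat[of _ n n _ n])
    also have "\<dots> = G * (A * B) * H"
      using A B G H by (simp add: HG assoc_mult_mat[of _ n n _ n _ n] mult_carrier_mat[of _ n n _ n])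
    finally show ?thesis by simp
  qed
  moreover have "G * (A + B) * H = G * A * H + G * B * H"
    if A: "A \<in> carrier_mat n n" and B: "B \<in> carrier_mat n n" for A B
    using A B G H by (simp add: mult_add_distrib_mat[of _ n n _ n] add_mult_distrib_mat[of _ n n _ _ n])
  moreover have "G * (c \<cdot>\<^sub>m A) * H = c \<cdot>\<^sub>m (G * A * H)" if "A \<in> carrier_mat n n" for c A
    using that G H by (simp add: mult_smult_distrib[of _ n n] mult_smult_assoc_mat[of _ n n])
  ultimately show ?thesis
    using G H GH by (simp add: mat_alg_endo_def)
qed

lemma mat_alg_endo_permute:
  assumes \<pi>: "\<pi> permutes {0..<n}"
  shows "mat_alg_endo n (\<lambda>A. mat n n (\<lambda>(a,b). A $$ (\<pi> a, \<pi> b)))"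
proof -
  have lt: "\<pi> a < n" if "a < n" for a
    using permutes_in_image[OF \<pi>, of a] that by simp
  have inj: "\<pi> a = \<pi> b \<longleftrightarrow> a = b" for a b
    using permutes_inj[OF \<pi>] by (auto dest: injD)
  have "mat n n (\<lambda>(a,b). (A * B) $$ (\<pi> a, \<pi> b)) =
      mat n n (\<lambda>(a,b). A $$ (\<pi> a, \<pi> b)) * mat n n (\<lambda>(a,b). B $$ (\<pi> a, \<pi> b))"
    if "A \<in> carrier_mat n n" "B \<in> carrier_mat n n" for A B :: "'a mat"
  proof (rule eq_matI)
    fix a b assume "a < dim_row (mat n n (\<lambda>(a,b). A $$ (\<pi> a, \<pi> b)) * mat n n (\<lambda>(a,b). B $$ (\<pi> a, \<pi> b)))"
       "b < dim_col (mat n n (\<lambda>(a,b). A $$ (\<pi> a, \<pi> b)) * mat n n (\<lambda>(a,b). B $$ (\<pi> a, \<pi> b)))"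
    then have ab: "a < n" "b < n" by auto
    have "(\<Sum>c = 0..<n. A $$ (\<pi> a, c) * B $$ (c, \<pi> b)) = (\<Sum>c = 0..<n. A $$ (\<pi> a, \<pi> c) * B $$ (\<pi> c, \<pi> b))"
      using sum.permute[OF \<pi>, of "\<lambda>c. A $$ (\<pi> a, c) * B $$ (c, \<pi> b)"] by (simp add: o_def)
    then show "mat n n (\<lambda>(a,b). (A * B) $$ (\<pi> a, \<pi> b)) $$ (a,b) =
      (mat n n (\<lambda>(a,b). A $$ (\<pi> a, \<pi> b)) * mat n n (\<lambda>(a,b). B $$ (\<pi> a, \<pi> b))) $$ (a,b)"
      using ab that lt by (simp add: scalar_prod_def)
  qed auto
  then show ?thesis
    unfolding mat_alg_endo_def using lt inj
    by (auto intro!: eq_matI)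
qed

section \<open>Polynomial functions over an infinite field\<close>

text \<open>
  Being polynomial along every line follows from being a polynomial in the coordinates, is closed
  under the ring operations and is already enough to exclude zero divisors over an infinite field,
  so that univariate polynomials suffice.
\<close>
definition poly_on_lines :: "(('i \<Rightarrow> 'a::field) \<Rightarrow> 'a) \<Rightarrow> bool" where
  "poly_on_lines f \<longleftrightarrow> (\<forall>\<sigma> \<tau>. \<exists>q. \<forall>t. f (\<lambda>i. \<sigma> i + t * \<tau> i) = poly q t)"

lemma poly_on_lines_const: "poly_on_lines (\<lambda>_. c)"
  unfolding poly_on_lines_def by (metis poly_0 poly_pCons mult_zero_right add.right_neutral)

lemma poly_on_lines_coord: "poly_on_lines (\<lambda>\<sigma> :: 'i \<Rightarrow> 'a::field. \<sigma> i)"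
proof -
  have "\<exists>q. \<forall>t. \<sigma> i + t * \<tau> i = poly q t" for \<sigma> \<tau> :: "'i \<Rightarrow> 'a"
    by (rule exI[of _ "[:\<sigma> i, \<tau> i:]"]) simp
  then show ?thesis unfolding poly_on_lines_def by blast
qed

lemma poly_on_lines_add: "poly_on_lines f \<Longrightarrow> poly_on_lines g \<Longrightarrow> poly_on_lines (\<lambda>\<sigma>. f \<sigma> + g \<sigma>)"
  unfolding poly_on_lines_def by (metis poly_add)

lemma poly_on_lines_mult: "poly_on_lines f \<Longrightarrow> poly_on_lines g \<Longrightarrow> poly_on_lines (\<lambda>\<sigma>. f \<sigma> * g \<sigma>)"
  unfolding poly_on_lines_def by (metis poly_mult)

lemma poly_on_lines_uminus: "poly_on_lines f \<Longrightarrow> poly_on_lines (\<lambda>\<sigma>. - f \<sigma>)"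
  unfolding poly_on_lines_def by (metis poly_minus)

lemma poly_on_lines_sum:
  "(\<And>i. i \<in> I \<Longrightarrow> poly_on_lines (f i)) \<Longrightarrow> poly_on_lines (\<lambda>\<sigma>. \<Sum>i\<in>I. f i \<sigma>)"
  by (induction I rule: infinite_finite_induct) (auto intro: poly_on_lines_const poly_on_lines_add)

lemma poly_on_lines_prod:
  "(\<And>i. i \<in> I \<Longrightarrow> poly_on_lines (f i)) \<Longrightarrow> poly_on_lines (\<lambda>\<sigma>. \<Prod>i\<in>I. f i \<sigma>)"
  by (induction I rule: infinite_finite_induct) (auto intro: poly_on_lines_const poly_on_lines_mult)

lemma poly_on_lines_power: "poly_on_lines f \<Longrightarrow> poly_on_lines (\<lambda>\<sigma>. f \<sigma> ^ k)"
  by (induction k) (auto intro: poly_on_lines_const poly_on_lines_mult)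

text \<open>
  On the line that joins a nonzero point of \<open>f\<close> to one of \<open>g\<close>, both
  functions are nonzero univariate polynomials, and their product has only finitely many roots.
\<close>
lemma poly_on_lines_nonzero_common_pair:
  fixes f g :: "('i \<Rightarrow> 'a::field) \<Rightarrow> 'a"
  assumes inf: "infinite (UNIV :: 'a set)"
    and f: "poly_on_lines f" "f \<sigma> \<noteq> 0" and g: "poly_on_lines g" "g \<tau> \<noteq> 0"
  shows "\<exists>\<rho>. f \<rho> \<noteq> 0 \<and> g \<rho> \<noteq> 0"
proof -
  define line where "line t = (\<lambda>i. \<sigma> i + t * (\<tau> i - \<sigma> i))" for t
  obtain q r where q: "\<And>t. f (line t) = poly q t" and r: "\<And>t. g (line t) = poly r t"
    using f(1) g(1) unfolding poly_on_lines_def line_def by metis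
  have "line 0 = \<sigma>" "line 1 = \<tau>" by (auto simp: line_def)
  then have "poly q 0 \<noteq> 0" "poly r 1 \<noteq> 0" using f g q r by metis+
  then have "q * r \<noteq> 0" by auto
  then have "finite {t. poly (q * r) t = 0}" by (rule poly_roots_finite)
  then obtain t where "poly (q * r) t \<noteq> 0"
    using inf by (metis (mono_tags, lifting) UNIV_eq_I mem_Collect_eq)
  then show ?thesis using q r by (metis poly_mult mult_eq_0_iff)
qed

lemma poly_on_lines_nonzero_common:
  fixes f :: "'k \<Rightarrow> ('i \<Rightarrow> 'a::field) \<Rightarrow> 'a"
  assumes inf: "infinite (UNIV :: 'a set)" and "finite I"
    and "\<And>k. k \<in> I \<Longrightarrow> poly_on_lines (f k)" and "\<And>k. k \<in> I \<Longrightarrow> \<exists>\<sigma>. f k \<sigma> \<noteq> 0"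
  shows "\<exists>\<sigma>. \<forall>k\<in>I. f k \<sigma> \<noteq> 0"
  using assms(2-)
proof (induction I rule: finite_induct)
  case (insert k I)
  then obtain \<sigma> where "\<forall>k\<in>I. f k \<sigma> \<noteq> 0" by auto
  then have "(\<Prod>k\<in>I. f k \<sigma>) \<noteq> 0" using insert by simp
  moreover obtain \<tau> where "f k \<tau> \<noteq> 0" using insert.prems(2)[of k] by blast
  ultimately obtain \<rho> where "(\<Prod>k\<in>I. f k \<rho>) \<noteq> 0" "f k \<rho> \<noteq> 0"
    using poly_on_lines_nonzero_common_pair[OF inf, of "\<lambda>\<sigma>. \<Prod>k\<in>I. f k \<sigma>" \<sigma> "f k" \<tau>] insert
      poly_on_lines_prod[of I f] by auto
  then show ?case using insert by auto
qed auto

section \<open>Matrices whose entries are polynomial functions\<close>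

definition mat_poly_on_lines :: "nat \<Rightarrow> (('i \<Rightarrow> 'a::field) \<Rightarrow> 'a mat) \<Rightarrow> bool" where
  "mat_poly_on_lines n A \<longleftrightarrow>
     (\<forall>\<sigma>. A \<sigma> \<in> carrier_mat n n) \<and> (\<forall>i<n. \<forall>j<n. poly_on_lines (\<lambda>\<sigma>. A \<sigma> $$ (i,j)))"

lemma mat_poly_on_lines_one: "mat_poly_on_lines n (\<lambda>_. 1\<^sub>m n)"
  by (auto simp: mat_poly_on_lines_def poly_on_lines_const)

lemma mat_poly_on_lines_mult:
  assumes A: "mat_poly_on_lines n A" and B: "mat_poly_on_lines n B"
  shows "mat_poly_on_lines n (\<lambda>\<sigma>. A \<sigma> * B \<sigma>)"
proof -
  have C: "A \<sigma> \<in> carrier_mat n n" "B \<sigma> \<in> carrier_mat n n" for \<sigma>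
    using A B by (auto simp: mat_poly_on_lines_def)
  have "(\<lambda>\<sigma>. (A \<sigma> * B \<sigma>) $$ (i,j)) = (\<lambda>\<sigma>. \<Sum>c\<in>{0..<n}. A \<sigma> $$ (i,c) * B \<sigma> $$ (c,j))"
    if "i < n" "j < n" for i j
    using that by (simp add: scalar_prod_def carrier_matD[OF C(1)] carrier_matD[OF C(2)])
  moreover have "poly_on_lines (\<lambda>\<sigma>. \<Sum>c\<in>{0..<n}. A \<sigma> $$ (i,c) * B \<sigma> $$ (c,j))" if "i < n" "j < n" for i j
    using A B that by (intro poly_on_lines_sum poly_on_lines_mult) (auto simp: mat_poly_on_lines_def)
  ultimately show ?thesis
    using C unfolding mat_poly_on_lines_def by (auto intro!: mult_carrier_mat[of _ n n])
qed

lemma mat_poly_on_lines_pow: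
  assumes A: "mat_poly_on_lines n A"
  shows "mat_poly_on_lines n (\<lambda>\<sigma>. A \<sigma> ^\<^sub>m k)"
proof (induction k)
  case 0
  have "dim_row (A \<sigma>) = n" for \<sigma> using A by (auto simp: mat_poly_on_lines_def)
  then show ?case by (simp add: mat_poly_on_lines_one)
next
  case (Suc k)
  then show ?case using mat_poly_on_lines_mult[OF _ A] by simp
qed

lemma mat_poly_on_lines_ncpoly_eval:
  assumes Y: "\<And>i. mat_poly_on_lines n (\<lambda>\<sigma>. Y \<sigma> i)"
  shows "mat_poly_on_lines n (\<lambda>\<sigma>. ncpoly_eval n (Y \<sigma>) p)"
proof -
  have C: "\<forall>i. Y \<sigma> i \<in> carrier_mat n n" for \<sigma>
    using Y by (auto simp: mat_poly_on_lines_def)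
  have "mat_poly_on_lines n (\<lambda>\<sigma>. word_eval n (Y \<sigma>) (NCWord xs))" for xs
  proof (induction xs)
    case Nil
    then show ?case by (simp add: word_eval_def mat_poly_on_lines_one)
  next
    case (Cons x xs)
    then show ?case using mat_poly_on_lines_mult[OF Y] by (simp add: word_eval_Cons)
  qed
  then have W: "mat_poly_on_lines n (\<lambda>\<sigma>. word_eval n (Y \<sigma>) w)" for w
    by (cases w) simp
  show ?thesis
    unfolding mat_poly_on_lines_def
  proof (intro conjI allI impI ncpoly_eval_carrier[OF C])
    fix i j assume ij: "i < n" "j < n"
    have "poly_on_lines (\<lambda>\<sigma>. \<Sum>w\<in>Poly_Mapping.keys p. Poly_Mapping.lookup p w * word_eval n (Y \<sigma>) w $$ (i,j))"
      using W ij by (intro poly_on_lines_sum poly_on_lines_mult poly_on_lines_const) (auto simp: mat_poly_on_lines_def)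
    then show "poly_on_lines (\<lambda>\<sigma>. ncpoly_eval n (Y \<sigma>) p $$ (i,j))"
      by (simp add: ncpoly_eval_entry[OF C ij])
  qed
qed

lemma poly_on_lines_coeff_mult:
  assumes "\<And>k. poly_on_lines (\<lambda>\<sigma>. coeff (f \<sigma>) k)" "\<And>k. poly_on_lines (\<lambda>\<sigma>. coeff (g \<sigma>) k)"
  shows "poly_on_lines (\<lambda>\<sigma>. coeff (f \<sigma> * g \<sigma>) k)"
  unfolding coeff_mult using assms by (intro poly_on_lines_sum poly_on_lines_mult)

lemma poly_on_lines_coeff_prod:
  assumes "\<And>i k. i \<in> I \<Longrightarrow> poly_on_lines (\<lambda>\<sigma>. coeff (f i \<sigma>) k)"
  shows "poly_on_lines (\<lambda>\<sigma>. coeff (\<Prod>i\<in>I. f i \<sigma>) k)"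
  using assms
  by (induction I arbitrary: k rule: infinite_finite_induct)
     (auto intro: poly_on_lines_const poly_on_lines_coeff_mult)

lemma poly_on_lines_coeff_char_poly:
  assumes A: "mat_poly_on_lines n A"
  shows "poly_on_lines (\<lambda>\<sigma>. coeff (char_poly (A \<sigma>)) k)"
proof -
  have C: "A \<sigma> \<in> carrier_mat n n" for \<sigma>
    using A by (auto simp: mat_poly_on_lines_def)
  have "poly_on_lines (\<lambda>\<sigma>. coeff (char_poly_matrix (A \<sigma>) $$ (i,j)) k)" if ij: "i < n" "j < n" for i j k
  proof -
    have "(\<lambda>\<sigma>. coeff (char_poly_matrix (A \<sigma>) $$ (i,j)) k) =
        (\<lambda>\<sigma>. (if i = j \<and> k = 1 then 1 else 0) + (if k = 0 then - (A \<sigma> $$ (i,j)) else 0))"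
      using ij by (auto simp: char_poly_matrix_def carrier_matD[OF C] fun_eq_iff coeff_pCons split: nat.split)
    moreover have "poly_on_lines (\<lambda>\<sigma>. A \<sigma> $$ (i,j))"
      using A ij by (auto simp: mat_poly_on_lines_def)
    ultimately show ?thesis
      by (cases "k = 0") (auto intro!: poly_on_lines_add poly_on_lines_const poly_on_lines_uminus)
  qed
  moreover have "\<pi> i < n" if "\<pi> permutes {0..<n}" "i < n" for \<pi> i
    using permutes_in_image[OF that(1), of i] that(2) by simp
  ultimately show ?thesis
    unfolding char_poly_def det_def'[OF char_poly_matrix_closed[OF C]] coeff_sum
    by (intro poly_on_lines_sum poly_on_lines_coeff_mult poly_on_lines_coeff_prod poly_on_lines_const) auto
qed

section \<open>Characteristic polynomials with only two terms\<close>

text \<open>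
  In the Leibniz expansion of the characteristic polynomial only two kinds of permutations
  contribute. A permutation that moves every point \<open>a\<close> to \<open>a\<close> or to
  \<open>a + 1\<close> and fixes one point fixes its successor as well, since nothing else is left
  to be mapped there; so it is the identity and contributes \<open>x ^ n\<close>. A permutation
  without fixed points contributes a constant.
\<close>
lemma char_poly_middle_coeff_cyclic:
  fixes A :: "'a::field mat"
  assumes A: "A \<in> carrier_mat n n"
    and cyc: "\<And>a b. a < n \<Longrightarrow> b < n \<Longrightarrow> A $$ (a,b) \<noteq> 0 \<Longrightarrow> b = (a + 1) mod n"
    and j: "0 < j" "j < n"
  shows "coeff (char_poly A) j = 0"
proof -
  have step: "(a + 1) mod n \<noteq> a" if "a < n" for a
    using that j by (cases "a + 1 = n") auto
  let ?M = "char_poly_matrix A"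
  have M: "?M $$ (a,b) = (if a = b then [:0,1:] else [:- (A $$ (a,b)):])" if "a < n" "b < n" for a b
  proof -
    have "A $$ (a,a) = 0" using cyc[of a a] step[of a] that by fastforce
    then show ?thesis using that A by (auto simp: char_poly_matrix_def)
  qed
  have "coeff (signof \<pi> * (\<Prod>i = 0..<n. ?M $$ (i, \<pi> i))) j = 0" if \<pi>: "\<pi> permutes {0..<n}" for \<pi>
  proof -
    have lt: "\<pi> a < n" if "a < n" for a
      using permutes_in_image[OF \<pi>, of a] that by simp
    have "coeff (\<Prod>i = 0..<n. ?M $$ (i, \<pi> i)) j = 0"
    proof (cases "(\<exists>i<n. \<pi> i = i) \<and> (\<Prod>i = 0..<n. ?M $$ (i, \<pi> i)) \<noteq> 0")
      case True
      then obtain i where i: "i < n" "\<pi> i = i" by auto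
      have nz: "\<pi> a = a \<or> \<pi> a = (a + 1) mod n" if "a < n" for a
      proof -
        have "?M $$ (a, \<pi> a) \<noteq> 0" using True that by auto
        then show ?thesis using M[OF that lt[OF that]] cyc[OF that lt[OF that]] by (auto split: if_splits)
      qed
      have "\<pi> ((i + k) mod n) = (i + k) mod n" for k
      proof (induction k)
        case 0
        then show ?case using i by simp
      next
        case (Suc k)
        let ?a = "(i + k) mod n" and ?b = "(i + Suc k) mod n"
        have a: "?a < n" and b: "?b < n" using j by simp_all
        have s: "(?a + 1) mod n = ?b" by (simp add: mod_simps)
        \<comment> \<open>The preimage of \<open>?b\<close> is \<open>?b\<close> or its predecessor
          \<open>?a\<close>, and \<open>?a\<close> is fixed.\<close>
        obtain c where c: "\<pi> c = ?b" "c < n"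
          using permutes_image[OF \<pi>] b by (metis atLeastLessThan_iff imageE zero_le)
        have "c \<noteq> ?a" using c Suc step[OF a] s by auto
        moreover have "(x + 1) mod n = (if x + 1 = n then 0 else x + 1)" if "x < n" for x
          using that by auto
        ultimately have "(c + 1) mod n \<noteq> ?b"
          using c(2) a unfolding s[symmetric] by (auto split: if_splits)
        then show ?case using nz[OF c(2)] c(1) by auto
      qed
      have fixed: "\<pi> b = b" if "b < n" for b
        using \<open>\<And>k. \<pi> ((i + k) mod n) = (i + k) mod n\<close>[of "n - i + b"] i that by simp
      have "(\<Prod>i = 0..<n. ?M $$ (i, \<pi> i)) = (\<Prod>i = 0..<n. [:0,1:])"
        by (rule prod.cong) (auto simp: fixed M)
      also have "\<dots> = monom 1 n"
        by (simp add: x_as_monom monom_power)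
      finally show ?thesis using j by simp
    next
      case False
      then consider "(\<Prod>i = 0..<n. ?M $$ (i, \<pi> i)) = 0" | "\<And>i. i < n \<Longrightarrow> \<pi> i \<noteq> i" by blast
      then show ?thesis
      proof cases
        case 2
        have "degree (\<Prod>i = 0..<n. ?M $$ (i, \<pi> i)) \<le> (\<Sum>i = 0..<n. degree (?M $$ (i, \<pi> i)))"
          using degree_prod_sum_le[of "{0..<n}" "\<lambda>i. ?M $$ (i, \<pi> i)"] by (simp add: o_def)
        also have "\<dots> = 0"
          using 2 lt by (intro sum.neutral) (auto simp: M dest!: sym[of _ "\<pi> _"])
        finally show ?thesis using j by (intro coeff_eq_0) auto
      qed (simp only: coeff_0)
    qed
    then show ?thesis by (cases \<pi> rule: sign_cases) simp_all
  qed
  then show ?thesis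
    unfolding char_poly_def det_def'[OF char_poly_matrix_closed[OF A]] coeff_sum
    by (intro sum.neutral) auto
qed

lemma pow_mat_Suc_left:
  fixes A :: "'a::semiring_1 mat"
  assumes A: "A \<in> carrier_mat n n"
  shows "A ^\<^sub>m Suc k = A * A ^\<^sub>m k"
proof (induction k)
  case 0
  then show ?case using A by simp
next
  case (Suc k)
  have "A ^\<^sub>m Suc (Suc k) = A * A ^\<^sub>m k * A" using Suc by simp
  also have "\<dots> = A * A ^\<^sub>m Suc k"
    using assoc_mult_mat[OF A pow_carrier_mat[OF A, of k] A] by simp
  finally show ?case .
qed

text \<open>
  This is the Cayley-Hamilton argument for a two-term characteristic polynomial. Comparing the
  coefficients in \<open>(x - A) * D = char_poly A\<close>, with \<open>D\<close> the adjugate of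
  \<open>x - A\<close> and \<open>B k\<close> its coefficient matrix at \<open>x ^ k\<close>,
  gives a downward recursion for \<open>B\<close>. As the middle coefficients vanish, it makes
  \<open>B 0\<close> equal to \<open>A ^ (n - 1)\<close>, and the constant coefficient of the
  identity gives \<open>A * B 0\<close>.
\<close>
lemma pow_eq_scalar_of_char_poly:
  fixes A :: "'a::field mat"
  assumes A: "A \<in> carrier_mat n n" and n: "n \<ge> 1"
    and mid: "\<And>j. 0 < j \<Longrightarrow> j < n \<Longrightarrow> coeff (char_poly A) j = 0"
  shows "A ^\<^sub>m n = (- coeff (char_poly A) 0) \<cdot>\<^sub>m 1\<^sub>m n"
proof -
  define D where "D = adj_mat (char_poly_matrix A)"
  define B where "B k = mat n n (\<lambda>ab. coeff (D $$ ab) k)" for k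
  note N = char_poly_matrix_closed[OF A]
  have D: "D \<in> carrier_mat n n" "char_poly_matrix A * D = char_poly A \<cdot>\<^sub>m 1\<^sub>m n"
    using adj_mat[OF N] by (auto simp: D_def char_poly_def)
  have B: "B k \<in> carrier_mat n n" for k by (simp add: B_def)
  have deg: "degree (char_poly A) = n" "coeff (char_poly A) n = 1"
    using degree_monic_char_poly[OF A] by auto
  have entry: "[:0,1:] * D $$ (a,b) - (\<Sum>c = 0..<n. [:A $$ (a,c):] * D $$ (c,b)) = (if a = b then char_poly A else 0)"
    if ab: "a < n" "b < n" for a b
  proof -
    have "(\<Sum>c = 0..<n. char_poly_matrix A $$ (a,c) * D $$ (c,b)) = (if a = b then char_poly A else 0)"
      using arg_cong[OF D(2), of "\<lambda>M. M $$ (a,b)"] ab carrier_matD[OF D(1)] carrier_matD[OF N]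
      by (simp add: scalar_prod_def)
    moreover have "char_poly_matrix A $$ (a,c) * D $$ (c,b) =
        (if c = a then [:0,1:] * D $$ (c,b) else 0) - [:A $$ (a,c):] * D $$ (c,b)" if "c < n" for c
      using that ab A by (auto simp: char_poly_matrix_def algebra_simps smult_add_left)
    ultimately show ?thesis using ab by (simp add: sum_subtractf)
  qed
  have AB: "(A * B k) $$ (a,b) = coeff (\<Sum>c = 0..<n. [:A $$ (a,c):] * D $$ (c,b)) k" if "a < n" "b < n" for a b k
    using that A by (simp add: B_def scalar_prod_def coeff_sum)
  have B0: "A * B 0 = (- coeff (char_poly A) 0) \<cdot>\<^sub>m 1\<^sub>m n"
  proof (rule eq_matI)
    fix a b assume "a < dim_row ((- coeff (char_poly A) 0) \<cdot>\<^sub>m (1\<^sub>m n :: 'a mat))"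
      "b < dim_col ((- coeff (char_poly A) 0) \<cdot>\<^sub>m (1\<^sub>m n :: 'a mat))"
    then have ab: "a < n" "b < n" by auto
    have "- coeff (\<Sum>c = 0..<n. [:A $$ (a,c):] * D $$ (c,b)) 0 = coeff (if a = b then char_poly A else 0) 0"
      using arg_cong[OF entry[OF ab], of "\<lambda>p. coeff p 0"] by (simp add: coeff_mult_0)
    then have "(A * B 0) $$ (a,b) = - coeff (if a = b then char_poly A else 0) 0"
      unfolding AB[OF ab] by (metis minus_minus)
    then show "(A * B 0) $$ (a,b) = ((- coeff (char_poly A) 0) \<cdot>\<^sub>m 1\<^sub>m n) $$ (a,b)"
      using ab by simp
  qed (use A B in auto)
  have Bs: "B k = A * B (Suc k) + coeff (char_poly A) (Suc k) \<cdot>\<^sub>m 1\<^sub>m n" for k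
  proof (rule eq_matI)
    fix a b assume "a < dim_row (A * B (Suc k) + coeff (char_poly A) (Suc k) \<cdot>\<^sub>m 1\<^sub>m n)"
      "b < dim_col (A * B (Suc k) + coeff (char_poly A) (Suc k) \<cdot>\<^sub>m 1\<^sub>m n)"
    then have ab: "a < n" "b < n" by auto
    have "B k $$ (a,b) = coeff ([:0,1:] * D $$ (a,b)) (Suc k)"
      using ab by (simp add: B_def)
    also have "[:0,1:] * D $$ (a,b) =
        (\<Sum>c = 0..<n. [:A $$ (a,c):] * D $$ (c,b)) + (if a = b then char_poly A else 0)"
      using entry[OF ab] by (simp add: algebra_simps)
    also have "coeff \<dots> (Suc k) = (A * B (Suc k) + coeff (char_poly A) (Suc k) \<cdot>\<^sub>m 1\<^sub>m n) $$ (a,b)"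
      using ab A B by (simp add: AB)
    finally show "B k $$ (a,b) = (A * B (Suc k) + coeff (char_poly A) (Suc k) \<cdot>\<^sub>m 1\<^sub>m n) $$ (a,b)" .
  qed (use A B in auto)
  \<comment> \<open>From the index \<open>m\<close> on, \<open>B\<close> vanishes by the degrees of the
    entries of \<open>D\<close>; the recursion then carries the vanishing down to the index
    \<open>n\<close>.\<close>
  define m where "m = Max ((\<lambda>ab. degree (D $$ ab)) ` ({0..<n} \<times> {0..<n})) + Suc n"
  have big: "B k = 0\<^sub>m n n" if "k \<ge> m" for k
  proof (rule eq_matI)
    fix a b assume "a < dim_row (0\<^sub>m n n)" "b < dim_col (0\<^sub>m n n)"
    then have ab: "a < n" "b < n" by auto
    then have "degree (D $$ (a,b)) \<le> Max ((\<lambda>ab. degree (D $$ ab)) ` ({0..<n} \<times> {0..<n}))"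
      by (intro Max_ge) auto
    then have "degree (D $$ (a,b)) < k" using that by (simp add: m_def)
    then show "B k $$ (a,b) = 0\<^sub>m n n $$ (a,b)" using ab by (simp add: B_def coeff_eq_0)
  qed (auto simp: B_def)
  have zero: "B k = 0\<^sub>m n n" if "k \<ge> n" for k
  proof (cases "k \<ge> m")
    case False
    then have "k \<le> m" by simp
    then show ?thesis using that
    proof (induction rule: inc_induct)
      case base
      then show ?case using big by simp
    next
      case (step k)
      then have "B (Suc k) = 0\<^sub>m n n" "coeff (char_poly A) (Suc k) = 0"
        using deg by (auto intro: coeff_eq_0)
      then show ?case using Bs[of k] A by auto
    qed
  qed (use big in simp)
  have "B (n - Suc i) = A ^\<^sub>m i" if "i < n" for i
    using that
  proof (induction i)
    case 0
    have "B (n - 1) = A * B n + 1 \<cdot>\<^sub>m 1\<^sub>m n"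
      using Bs[of "n - 1"] n deg by simp
    moreover have "1 \<cdot>\<^sub>m 1\<^sub>m n = (1\<^sub>m n :: 'a mat)" by (intro eq_matI) auto
    ultimately show ?case using A zero[of n] by simp
  next
    case (Suc i)
    have e: "Suc (n - Suc (Suc i)) = n - Suc i" using Suc.prems by simp
    have "coeff (char_poly A) (n - Suc i) = 0" using Suc.prems by (intro mid) auto
    moreover have "0 \<cdot>\<^sub>m 1\<^sub>m n = (0\<^sub>m n n :: 'a mat)" by (intro eq_matI) auto
    moreover have "A * A ^\<^sub>m i \<in> carrier_mat n n"
      using A by (auto intro!: mult_carrier_mat[of _ n n] pow_carrier_mat)
    ultimately have "B (n - Suc (Suc i)) = A * A ^\<^sub>m i"
      using Bs[of "n - Suc (Suc i)"] Suc A unfolding e by simp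
    also have "\<dots> = A ^\<^sub>m Suc i"
      by (rule pow_mat_Suc_left[OF A, symmetric])
    finally show ?case .
  qed
  from this[of "n - 1"] n have "B 0 = A ^\<^sub>m (n - 1)" by simp
  then show ?thesis using B0 n pow_mat_Suc_left[OF A, of "n - 1"] by simp
qed

section \<open>Characteristic polynomials of roots of scalar matrices\<close>

text \<open>
  Scaling all roots by \<open>c\<close> scales the coefficient of \<open>x ^ j\<close> by \<open>c
  ^ (length zs - j)\<close>; multiplying by \<open>c ^ j\<close> avoids the subtraction of
  exponents.
\<close>
lemma coeff_prod_linear_scale:
  fixes c :: "'a::comm_ring_1"
  shows "coeff (\<Prod>z\<leftarrow>zs. [:- (c * z), 1:]) j * c ^ j = c ^ length zs * coeff (\<Prod>z\<leftarrow>zs. [:- z, 1:]) j"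
proof (induction zs arbitrary: j)
  case Nil
  then show ?case by (cases j) auto
next
  case (Cons z zs)
  let ?p = "\<Prod>z\<leftarrow>zs. [:- (c * z), 1:]" and ?q = "\<Prod>z\<leftarrow>zs. [:- z, 1:]"
  show ?case
  proof (cases j)
    case 0
    then show ?thesis using Cons[of 0] by (simp add: coeff_mult_0 algebra_simps)
  next
    case (Suc i)
    have "coeff ([:- (c * z), 1:] * ?p) j * c ^ j
        = c * (coeff ?p i * c ^ i) - c * z * (coeff ?p j * c ^ j)"
      by (simp add: Suc algebra_simps)
    also have "\<dots> = c ^ Suc (length zs) * coeff ([:- z, 1:] * ?q) j"
      unfolding Cons by (simp add: Suc algebra_simps)
    finally show ?thesis by simp
  qed
qed

lemma char_poly_splits:
  fixes A :: "'a::alg_closed_field mat"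
  assumes A: "A \<in> carrier_mat n n"
  shows "\<exists>zs. length zs = n \<and> char_poly A = (\<Prod>z\<leftarrow>zs. [:- z, 1:])"
proof -
  have deg: "degree (char_poly A) = n" "lead_coeff (char_poly A) = 1" "char_poly A \<noteq> 0"
    using degree_monic_char_poly[OF A] by auto
  obtain M where M: "size M = n" "char_poly A = (\<Prod>z\<in>#M. [:- z, 1:])"
    using alg_closed_imp_factorization[OF deg(3)] deg by auto
  obtain zs where "mset zs = M" using ex_mset by blast
  then show ?thesis
    using M by (auto simp: prod_mset_prod_list simp flip: mset_map)
qed

lemma eigenvalue_power_of_scalar_pow:
  fixes A :: "'a::field mat"
  assumes A: "A \<in> carrier_mat n n" and pow: "A ^\<^sub>m \<nu> = s \<cdot>\<^sub>m 1\<^sub>m n" and ev: "eigenvalue A z"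
  shows "z ^ \<nu> = s"
proof -
  obtain v where v: "eigenvector A v z" using ev by (auto simp: eigenvalue_def)
  then have vc: "v \<in> carrier_vec n" "v \<noteq> 0\<^sub>v n" using A by (auto simp: eigenvector_def)
  have "z ^ \<nu> \<cdot>\<^sub>v v = s \<cdot>\<^sub>v v"
  proof -
    have "(s \<cdot>\<^sub>m 1\<^sub>m n) *\<^sub>v v = s \<cdot>\<^sub>v v"
      using vc(1) by (intro eq_vecI) auto
    then show ?thesis using eigenvector_pow[OF A v, of \<nu>] pow by simp
  qed
  moreover obtain i where "i < n" "v $ i \<noteq> 0" using vc by (metis carrier_vecD eq_vecI index_zero_vec)
  ultimately show ?thesis
    using vc by (metis carrier_vecD index_smult_vec(1) mult_right_cancel)
qed

text \<open>
  Over an algebraic closure the eigenvalues of \<open>A\<close> are \<open>c * u\<close> for one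
  fixed eigenvalue \<open>c\<close> and roots of unity \<open>u\<close>, so the coefficient of
  \<open>x ^ j\<close> is \<open>c ^ (n - j)\<close> times the corresponding coefficient for the
  \<open>u\<close> alone. Its \<open>\<nu>\<close>-th power replaces \<open>c ^ \<nu>\<close> by
  \<open>s\<close>. There are only finitely many choices of \<open>n\<close> roots of unity,
  whence the finite set.
\<close>
lemma char_poly_coeff_of_scalar_pow:
  assumes \<nu>: "\<nu> \<ge> 1" and n: "n \<ge> 1" and j: "0 < j"
  shows "\<exists>F :: 'a::field set. finite F \<and>
    (\<forall>A \<in> carrier_mat n n. \<forall>s. A ^\<^sub>m \<nu> = s \<cdot>\<^sub>m 1\<^sub>m n \<longrightarrow> (\<exists>v\<in>F. coeff (char_poly A) j ^ \<nu> * s ^ j = v * s ^ n))"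
proof -
  define G where "G = {zs :: 'a alg_closure list. set zs \<subseteq> {z. z ^ \<nu> = 1} \<and> length zs = n}"
  \<comment> \<open>For \<open>s \<noteq> 0\<close> the relation forces \<open>v\<close> to lie in the ground
    field, where \<open>of_ac\<close> recovers it; elements of the closure outside of the
    ground field go to arbitrary values. The value \<open>0\<close> serves for \<open>s =
    0\<close>.\<close>
  define F where "F = insert (0::'a) ((\<lambda>zs. of_ac (coeff (\<Prod>z\<leftarrow>zs. [:- z, 1:]) j ^ \<nu>)) ` G)"
  have "finite {z :: 'a alg_closure. z ^ \<nu> = 1}"
  proof -
    have "poly ([:0, 1:] ^ \<nu> - 1) (0 :: 'a alg_closure) \<noteq> 0"
      using \<nu> by (cases \<nu>) (auto simp: poly_power)
    then have "[:0, 1:] ^ \<nu> - 1 \<noteq> (0 :: 'a alg_closure poly)" by (metis poly_0)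
    from poly_roots_finite[OF this] show ?thesis by (simp add: poly_power)
  qed
  then have "finite F" unfolding F_def G_def by (simp add: finite_lists_length_eq)
  moreover have "\<exists>v\<in>F. coeff (char_poly A) j ^ \<nu> * s ^ j = v * s ^ n"
    if A: "A \<in> carrier_mat n n" and pow: "A ^\<^sub>m \<nu> = s \<cdot>\<^sub>m 1\<^sub>m n" for A s
  proof (cases "s = 0")
    case True
    then show ?thesis using j n by (auto simp: F_def)
  next
    case False
    interpret h: inj_comm_ring_hom "to_ac :: 'a \<Rightarrow> 'a alg_closure"
      by unfold_locales auto
    define B where "B = map_mat to_ac A"
    have B: "B \<in> carrier_mat n n" using A by (simp add: B_def)
    have Bpow: "B ^\<^sub>m \<nu> = to_ac s \<cdot>\<^sub>m 1\<^sub>m n"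
      unfolding B_def h.mat_hom_pow[OF A, symmetric] pow
      by (intro eq_matI) auto
    obtain zs where zs: "length zs = n" "char_poly B = (\<Prod>z\<leftarrow>zs. [:- z, 1:])"
      using char_poly_splits[OF B] by blast
    have pow_zs: "z ^ \<nu> = to_ac s" if "z \<in> set zs" for z
    proof (rule eigenvalue_power_of_scalar_pow[OF B Bpow])
      have "poly (char_poly B) z = 0"
        unfolding zs(2) poly_prod_list prod_list_zero_iff using that by force
      then show "eigenvalue B z" using eigenvalue_root_char_poly[OF B] by simp
    qed
    define c where "c = hd zs"
    define us where "us = map (\<lambda>z. z / c) zs"
    have c: "c ^ \<nu> = to_ac s" using pow_zs[of c] zs(1) n by (cases zs) (auto simp: c_def)
    have c0: "c \<noteq> 0" using c False \<nu> by (cases \<nu>) auto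
    have us: "us \<in> G"
      using pow_zs c False zs(1) by (auto simp: G_def us_def power_divide)
    let ?e = "coeff (\<Prod>z\<leftarrow>us. [:- z, 1:]) j" and ?\<alpha> = "coeff (char_poly A) j"
    have "char_poly B = (\<Prod>z\<leftarrow>us. [:- (c * z), 1:])"
      using c0 unfolding zs(2) us_def by (simp add: o_def)
    moreover have "coeff (char_poly B) j = to_ac ?\<alpha>"
      unfolding B_def h.char_poly_hom[OF A] by simp
    ultimately have "to_ac ?\<alpha> * c ^ j = c ^ n * ?e"
      using coeff_prod_linear_scale[of c us j] zs(1) by (simp add: us_def)
    then have "(to_ac ?\<alpha> * c ^ j) ^ \<nu> = (c ^ n * ?e) ^ \<nu>" by simp
    then have "to_ac (?\<alpha> ^ \<nu> * s ^ j) = to_ac (s ^ n) * ?e ^ \<nu>"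
      using c by (simp add: power_mult_distrib flip: power_mult) (simp add: mult.commute power_mult)
    then have "?e ^ \<nu> = to_ac (?\<alpha> ^ \<nu> * s ^ j / s ^ n)"
      using False by (simp add: field_simps)
    then have "of_ac (?e ^ \<nu>) = ?\<alpha> ^ \<nu> * s ^ j / s ^ n" by (simp only: of_ac_to_ac)
    then have "?\<alpha> ^ \<nu> * s ^ j = of_ac (?e ^ \<nu>) * s ^ n" using False by simp
    moreover have "of_ac (?e ^ \<nu>) \<in> F" using us unfolding F_def by blast
    ultimately show ?thesis by blast
  qed
  ultimately show ?thesis by blast
qed

section \<open>The cyclic grading and multilinear polynomials\<close>

lemma multilinear_keys:
  assumes "multilinear m p" "w \<in> Poly_Mapping.keys p"
  obtains xs where "w = NCWord xs" "distinct xs" "set xs = {1..m}"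
proof -
  obtain \<pi> where \<pi>: "\<pi> permutes {1..m}" "w = NCWord (map \<pi> [1..<Suc m])"
    using assms by (auto simp: multilinear_def)
  show ?thesis
  proof (rule that[OF \<pi>(2)])
    show "distinct (map \<pi> [1..<Suc m])"
      using permutes_inj_on[OF \<pi>(1)] by (simp add: distinct_map del: upt_Suc)
    show "set (map \<pi> [1..<Suc m]) = {1..m}"
      using permutes_image[OF \<pi>(1)] by (simp add: atLeastLessThanSuc_atLeastAtMost del: upt_Suc)
  qed
qed

text \<open>
  Homogeneity of degree \<open>d\<close> for the grading of the matrix algebra by
  \<open>\<int>/n\<close> in which the matrix unit at \<open>(a,b)\<close> has degree \<open>b -
  a\<close>.
\<close>
definition cyc_graded :: "nat \<Rightarrow> nat \<Rightarrow> 'a::zero mat \<Rightarrow> bool" where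
  "cyc_graded n d A \<longleftrightarrow> (\<forall>a<n. \<forall>b<n. A $$ (a,b) \<noteq> 0 \<longrightarrow> b = (a + d) mod n)"

lemma cyc_graded_mult:
  fixes A B :: "'a::semiring_0 mat"
  assumes C: "A \<in> carrier_mat n n" "B \<in> carrier_mat n n"
    and A: "cyc_graded n d A" and B: "cyc_graded n e B"
  shows "cyc_graded n (d + e) (A * B)"
  unfolding cyc_graded_def
proof (intro allI impI)
  fix a b assume ab: "a < n" "b < n" and nz: "(A * B) $$ (a,b) \<noteq> 0"
  have "(A * B) $$ (a,b) = (\<Sum>c = 0..<n. A $$ (a,c) * B $$ (c,b))"
    using ab C by (simp add: scalar_prod_def)
  then obtain c where c: "c < n" "A $$ (a,c) * B $$ (c,b) \<noteq> 0"
    using nz by (auto elim: sum.not_neutral_contains_not_neutral)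
  then have "A $$ (a,c) \<noteq> 0" "B $$ (c,b) \<noteq> 0" by auto
  then have "c = (a + d) mod n" "b = (c + e) mod n"
    using A B ab c(1) unfolding cyc_graded_def by blast+
  then show "b = (a + (d + e)) mod n" by (simp add: mod_simps add.assoc)
qed

lemma cyc_graded_word_eval:
  assumes Y: "\<forall>i. Y i \<in> carrier_mat n n"
    and "\<And>x. x \<in> set xs \<Longrightarrow> cyc_graded n (d x) (Y x)"
  shows "cyc_graded n (\<Sum>x\<leftarrow>xs. d x) (word_eval n Y (NCWord xs))"
  using assms(2)
proof (induction xs)
  case Nil
  then show ?case by (auto simp: cyc_graded_def word_eval_def)
next
  case (Cons x xs)
  then show ?case
    using cyc_graded_mult[OF spec[OF Y, of x] word_eval_carrier[OF Y, of "NCWord xs"]]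
    by (simp add: word_eval_Cons)
qed

text \<open>
  Multilinearity enters here: each monomial contains every argument exactly once, so all monomials
  have the same degree, whatever the order of their letters.
\<close>
lemma cyc_graded_ncpoly_eval:
  assumes Y: "\<forall>i. Y i \<in> carrier_mat n n" and p: "multilinear m p"
    and gr: "\<And>k. k \<in> {1..m} \<Longrightarrow> cyc_graded n (d k) (Y k)"
  shows "cyc_graded n (\<Sum>k=1..m. d k) (ncpoly_eval n Y p)"
  unfolding cyc_graded_def
proof (intro allI impI)
  fix a b assume ab: "a < n" "b < n" and nz: "ncpoly_eval n Y p $$ (a,b) \<noteq> 0"
  then obtain w where w: "w \<in> Poly_Mapping.keys p" "Poly_Mapping.lookup p w * word_eval n Y w $$ (a,b) \<noteq> 0"
    unfolding ncpoly_eval_entry[OF Y ab] by (auto elim: sum.not_neutral_contains_not_neutral)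
  obtain xs where xs: "w = NCWord xs" "distinct xs" "set xs = {1..m}"
    using multilinear_keys[OF p w(1)] .
  have "(\<Sum>x\<leftarrow>xs. d x) = (\<Sum>k=1..m. d k)"
    using sum_list_distinct_conv_sum_set[OF xs(2), of d] xs(3) by simp
  then have "cyc_graded n (\<Sum>k=1..m. d k) (word_eval n Y w)"
    using cyc_graded_word_eval[OF Y, of xs d] gr xs by simp
  moreover have "word_eval n Y w $$ (a,b) \<noteq> 0" using w by auto
  ultimately show "b = (a + (\<Sum>k=1..m. d k)) mod n"
    using ab by (auto simp: cyc_graded_def)
qed

lemma word_eval_cong:
  assumes "\<And>x. x \<in> set xs \<Longrightarrow> Y x = Z x"
  shows "word_eval n Y (NCWord xs) = word_eval n Z (NCWord xs)"
  using assms by (induction xs) (auto simp: word_eval_def)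

text \<open>
  The coefficients come from cutting the word at its only occurrence of \<open>k\<close>.
\<close>
lemma word_eval_linear:
  fixes Y :: "nat \<Rightarrow> 'a::comm_ring_1 mat"
  assumes Y: "\<forall>i. Y i \<in> carrier_mat n n" and xs: "distinct xs" "k \<in> set xs" and ij: "i < n" "j < n"
  shows "\<exists>L. \<forall>M \<in> carrier_mat n n.
    word_eval n (Y(k := M)) (NCWord xs) $$ (i,j) = (\<Sum>e\<in>{0..<n}\<times>{0..<n}. L e * M $$ e)"
proof -
  obtain us vs where split: "xs = us @ k # vs" using xs(2) by (auto simp: in_set_conv_decomp)
  have notin: "k \<notin> set us" "k \<notin> set vs" using xs(1) split by auto
  define U where "U = word_eval n Y (NCWord us)"
  define V where "V = word_eval n Y (NCWord vs)"
  have UV: "U \<in> carrier_mat n n" "V \<in> carrier_mat n n"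
    unfolding U_def V_def by (rule word_eval_carrier[OF Y])+
  have "word_eval n (Y(k := M)) (NCWord xs) $$ (i,j) = (\<Sum>e\<in>{0..<n}\<times>{0..<n}. U $$ (i, fst e) * V $$ (snd e, j) * M $$ e)"
    if M: "M \<in> carrier_mat n n" for M
  proof -
    have Y': "\<forall>i. (Y(k := M)) i \<in> carrier_mat n n" using Y M by auto
    have "word_eval n (Y(k := M)) (NCWord us + NCWord (k # vs)) =
        word_eval n (Y(k := M)) (NCWord us) * word_eval n (Y(k := M)) (NCWord (k # vs))"
      by (rule word_eval_add[OF Y'])
    also have "NCWord us + NCWord (k # vs) = NCWord xs"
      by (simp add: plus_ncword_def split)
    also have "word_eval n (Y(k := M)) (NCWord us) = U"
      unfolding U_def using notin by (intro word_eval_cong) auto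
    also have "word_eval n (Y(k := M)) (NCWord (k # vs)) = M * V"
      unfolding V_def word_eval_Cons using notin
      by (auto intro!: arg_cong[of _ _ "(*) M"] word_eval_cong)
    finally have "word_eval n (Y(k := M)) (NCWord xs) $$ (i,j) = (U * (M * V)) $$ (i,j)"
      by (simp only:)
    also have "\<dots> = (\<Sum>a = 0..<n. U $$ (i,a) * (\<Sum>b = 0..<n. M $$ (a,b) * V $$ (b,j)))"
      using UV M ij by (simp add: scalar_prod_def)
    also have "\<dots> = (\<Sum>e\<in>{0..<n}\<times>{0..<n}. U $$ (i, fst e) * V $$ (snd e, j) * M $$ e)"
      by (simp add: sum_distrib_left sum.cartesian_product case_prod_unfold algebra_simps)
    finally show ?thesis .
  qed
  then show ?thesis
    by (intro exI[of _ "\<lambda>e. U $$ (i, fst e) * V $$ (snd e, j)"] ballI)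
qed

lemma ncpoly_eval_linear:
  fixes Y :: "nat \<Rightarrow> 'a::comm_ring_1 mat"
  assumes Y: "\<forall>i. Y i \<in> carrier_mat n n" and p: "multilinear m p" "k \<in> {1..m}" and ij: "i < n" "j < n"
  shows "\<exists>L. \<forall>M \<in> carrier_mat n n.
    ncpoly_eval n (Y(k := M)) p $$ (i,j) = (\<Sum>e\<in>{0..<n}\<times>{0..<n}. L e * M $$ e)"
proof -
  have "\<forall>w \<in> Poly_Mapping.keys p. \<exists>L. \<forall>M \<in> carrier_mat n n.
      word_eval n (Y(k := M)) w $$ (i,j) = (\<Sum>e\<in>{0..<n}\<times>{0..<n}. L e * M $$ e)"
  proof
    fix w assume "w \<in> Poly_Mapping.keys p"
    with p(1) obtain xs where "w = NCWord xs" "distinct xs" "set xs = {1..m}"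
      by (rule multilinear_keys)
    then show "\<exists>L. \<forall>M \<in> carrier_mat n n.
      word_eval n (Y(k := M)) w $$ (i,j) = (\<Sum>e\<in>{0..<n}\<times>{0..<n}. L e * M $$ e)"
      using word_eval_linear[OF Y _ _ ij, of xs k] p(2) by simp
  qed
  from bchoice[OF this] obtain L where "\<forall>w \<in> Poly_Mapping.keys p. \<forall>M \<in> carrier_mat n n.
      word_eval n (Y(k := M)) w $$ (i,j) = (\<Sum>e\<in>{0..<n}\<times>{0..<n}. L w e * M $$ e)" ..
  then have L: "word_eval n (Y(k := M)) w $$ (i,j) = (\<Sum>e\<in>{0..<n}\<times>{0..<n}. L w e * M $$ e)"
    if "w \<in> Poly_Mapping.keys p" "M \<in> carrier_mat n n" for w M
    using that by blast
  have "ncpoly_eval n (Y(k := M)) p $$ (i,j) =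
      (\<Sum>e\<in>{0..<n}\<times>{0..<n}. (\<Sum>w\<in>Poly_Mapping.keys p. Poly_Mapping.lookup p w * L w e) * M $$ e)"
    if M: "M \<in> carrier_mat n n" for M
  proof -
    have Y': "\<forall>i. (Y(k := M)) i \<in> carrier_mat n n" using Y M by auto
    have "ncpoly_eval n (Y(k := M)) p $$ (i,j) =
        (\<Sum>w\<in>Poly_Mapping.keys p. \<Sum>e\<in>{0..<n}\<times>{0..<n}. Poly_Mapping.lookup p w * L w e * M $$ e)"
      unfolding ncpoly_eval_entry[OF Y' ij]
      by (intro sum.cong refl) (simp only: L[OF _ M] sum_distrib_left mult.assoc)
    also have "\<dots> = (\<Sum>e\<in>{0..<n}\<times>{0..<n}. \<Sum>w\<in>Poly_Mapping.keys p. Poly_Mapping.lookup p w * L w e * M $$ e)"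
      by (rule sum.swap)
    finally show ?thesis by (simp only: sum_distrib_right)
  qed
  then show ?thesis
    by (intro exI[of _ "\<lambda>e. \<Sum>w\<in>Poly_Mapping.keys p. Poly_Mapping.lookup p w * L w e"] ballI)
qed

text \<open>
  By linearity, some single entry of the argument \<open>Y k\<close> already contributes to the
  chosen entry of the value. Keeping only that entry leaves a multiple of a matrix unit, which is
  homogeneous.
\<close>
lemma exists_cyc_graded_entry:
  fixes Y :: "nat \<Rightarrow> 'a::comm_ring_1 mat"
  assumes Y: "\<forall>i. Y i \<in> carrier_mat n n" and p: "multilinear m p" "k \<in> {1..m}" and ij: "i < n" "j < n"
    and nz: "ncpoly_eval n Y p $$ (i,j) \<noteq> 0"
  shows "\<exists>d M. M \<in> carrier_mat n n \<and> cyc_graded n d M \<and> ncpoly_eval n (Y(k := M)) p $$ (i,j) \<noteq> 0"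
proof -
  obtain L where L: "\<And>M. M \<in> carrier_mat n n \<Longrightarrow>
      ncpoly_eval n (Y(k := M)) p $$ (i,j) = (\<Sum>e\<in>{0..<n}\<times>{0..<n}. L e * M $$ e)"
    using ncpoly_eval_linear[OF Y p ij] by blast
  have "(\<Sum>e\<in>{0..<n}\<times>{0..<n}. L e * Y k $$ e) \<noteq> 0"
    using L[OF spec[OF Y, of k]] nz by simp
  then obtain a b where ab: "a < n" "b < n" "L (a,b) * Y k $$ (a,b) \<noteq> 0"
    by (auto elim: sum.not_neutral_contains_not_neutral)
  define M where "M = mat n n (\<lambda>e. if e = (a,b) then Y k $$ (a,b) else 0)"
  have M: "M \<in> carrier_mat n n" by (simp add: M_def)
  have "(\<Sum>e\<in>{0..<n}\<times>{0..<n}. L e * M $$ e) = (\<Sum>e\<in>{0..<n}\<times>{0..<n}. if e = (a,b) then L (a,b) * Y k $$ (a,b) else 0)"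
    by (rule sum.cong) (auto simp: M_def split: if_splits)
  also have "\<dots> = L (a,b) * Y k $$ (a,b)" using ab by simp
  finally have "ncpoly_eval n (Y(k := M)) p $$ (i,j) \<noteq> 0" using L[OF M] ab by simp
  \<comment> \<open>The degree is \<open>b - a\<close> modulo \<open>n\<close>, shifted by \<open>n\<close> to
    stay in the natural numbers.\<close>
  moreover have "cyc_graded n (n - a + b) M"
    using ab by (auto simp: cyc_graded_def M_def split: if_splits)
  ultimately show ?thesis using M by blast
qed

lemma exists_cyc_graded_args:
  fixes Y :: "nat \<Rightarrow> 'a::comm_ring_1 mat"
  assumes Y: "\<forall>i. Y i \<in> carrier_mat n n" and p: "multilinear m p" and ij: "i < n" "j < n"
    and nz: "ncpoly_eval n Y p $$ (i,j) \<noteq> 0"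
  obtains d Z where "\<forall>i. Z i \<in> carrier_mat n n" "\<forall>k\<in>{1..m}. cyc_graded n (d k) (Z k)"
    "ncpoly_eval n Z p $$ (i,j) \<noteq> 0"
proof -
  have "\<exists>d Z. (\<forall>i. Z i \<in> carrier_mat n n) \<and> (\<forall>k\<in>{1..l}. cyc_graded n (d k) (Z k)) \<and>
      ncpoly_eval n Z p $$ (i,j) \<noteq> 0" if "l \<le> m" for l
    using that
  proof (induction l)
    case 0
    then show ?case using Y nz by auto
  next
    case (Suc l)
    then obtain d Z where Z: "\<forall>i. Z i \<in> carrier_mat n n" "\<forall>k\<in>{1..l}. cyc_graded n (d k) (Z k)"
      "ncpoly_eval n Z p $$ (i,j) \<noteq> 0" by auto
    obtain e M where M: "M \<in> carrier_mat n n" "cyc_graded n e M"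
      "ncpoly_eval n (Z(Suc l := M)) p $$ (i,j) \<noteq> 0"
      using exists_cyc_graded_entry[OF Z(1) p _ ij Z(3), of "Suc l"] Suc.prems by auto
    have "\<forall>i. (Z(Suc l := M)) i \<in> carrier_mat n n" using Z(1) M(1) by simp
    moreover have "\<forall>k\<in>{1..Suc l}. cyc_graded n ((d(Suc l := e)) k) ((Z(Suc l := M)) k)"
      using Z(2) M(2) by (auto simp: le_Suc_eq)
    ultimately show ?case using M(3) by blast
  qed
  then show ?thesis using that by blast
qed

section \<open>Non-scalar values\<close>

text \<open>
  Conjugating the diagonal matrix \<open>A\<close> by the transvection \<open>1 + E\<close>, where
  \<open>E\<close> is the matrix unit at \<open>(i,j)\<close>, puts the difference of its
  \<open>i\<close>-th and \<open>j\<close>-th diagonal entries at the position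
  \<open>(i,j)\<close>.
\<close>
lemma scalar_if_transvections_keep_diagonal:
  fixes A :: "'a::comm_ring_1 mat"
  assumes A: "A \<in> carrier_mat n n" and diag: "diagonal_mat A"
    and conj: "\<And>i j. i < n \<Longrightarrow> j < n \<Longrightarrow> i \<noteq> j \<Longrightarrow>
      diagonal_mat (addrow_mat n 1 i j * A * addrow_mat n (- 1) i j)"
  shows "\<exists>c. A = c \<cdot>\<^sub>m 1\<^sub>m n"
proof -
  have off: "A $$ (i,j) = 0" if "i < n" "j < n" "i \<noteq> j" for i j
    using diag A that by (auto simp: diagonal_mat_def)
  have eq: "A $$ (i,i) = A $$ (j,j)" if ij: "i < n" "j < n" "i \<noteq> j" for i j
  proof -
    let ?G = "addrow_mat n 1 i j :: 'a mat" and ?H = "addrow_mat n (- 1) i j :: 'a mat"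
    have G: "?G \<in> carrier_mat n n" "?H \<in> carrier_mat n n" by auto
    have GA: "(?G * A) $$ (i,b) = A $$ (i,b) + A $$ (j,b)" if "b < n" for b
    proof -
      have "addrow 1 i j A $$ (i,b) = A $$ (i,b) + A $$ (j,b)"
        using that ij A by simp
      then show ?thesis using addrow_mat[OF A ij(2), of 1 i] by simp
    qed
    have "(?G * A * ?H) $$ (i,j) = (\<Sum>b = 0..<n. (?G * A) $$ (i,b) * ?H $$ (b,j))"
      using ij A G by (simp add: scalar_prod_def)
    also have "\<dots> = (\<Sum>b = 0..<n. (if b = i then - A $$ (i,i) else 0) + (if b = j then A $$ (j,j) else 0))"
      using ij by (intro sum.cong) (auto simp: GA off)
    also have "\<dots> = A $$ (j,j) - A $$ (i,i)" using ij by (simp add: sum.distrib)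
    finally have "(?G * A * ?H) $$ (i,j) = A $$ (j,j) - A $$ (i,i)" .
    moreover have "(?G * A * ?H) $$ (i,j) = 0"
      using conj[OF ij] ij A by (simp add: diagonal_mat_def)
    ultimately show ?thesis by simp
  qed
  have "A = A $$ (0,0) \<cdot>\<^sub>m 1\<^sub>m n"
  proof (rule eq_matI)
    fix i j assume "i < dim_row (A $$ (0,0) \<cdot>\<^sub>m 1\<^sub>m n)" "j < dim_col (A $$ (0,0) \<cdot>\<^sub>m 1\<^sub>m n)"
    then have ij: "i < n" "j < n" by auto
    have "A $$ (i,i) = A $$ (0,0)" using eq[of i 0] ij by (cases "i = 0") auto
    then show "A $$ (i,j) = (A $$ (0,0) \<cdot>\<^sub>m 1\<^sub>m n) $$ (i,j)" using ij off by auto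
  qed (use A in auto)
  then show ?thesis by blast
qed

text \<open>
  The values are closed under conjugation, so if all of them were diagonal, all of them would be
  scalar.
\<close>
lemma exists_nondiagonal_value:
  fixes p :: "'a::comm_ring_1 ncpoly"
  assumes Y: "\<forall>i. Y i \<in> carrier_mat n n" and ns: "\<nexists>c. ncpoly_eval n Y p = c \<cdot>\<^sub>m 1\<^sub>m n"
  obtains Z where "\<forall>i. Z i \<in> carrier_mat n n" "\<not> diagonal_mat (ncpoly_eval n Z p)"
proof (rule ccontr)
  assume contr: "\<not> thesis"
  have diag: "diagonal_mat (ncpoly_eval n Z p)" if "\<forall>i. Z i \<in> carrier_mat n n" for Z
    using that contr \<open>\<And>Z. \<forall>i. Z i \<in> carrier_mat n n \<Longrightarrow> \<not> diagonal_mat (ncpoly_eval n Z p) \<Longrightarrow> thesis\<close> by blast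
  have "diagonal_mat (addrow_mat n 1 i j * ncpoly_eval n Y p * addrow_mat n (- 1) i j)"
    if ij: "i < n" "j < n" "i \<noteq> j" for i j
  proof -
    let ?G = "addrow_mat n 1 i j :: 'a mat" and ?H = "addrow_mat n (- 1) i j :: 'a mat"
    have "mat_alg_endo n (\<lambda>A. ?G * A * ?H)"
      using addrow_mat_inv[OF ij, of "1::'a"] addrow_mat_inv[OF ij, of "- 1::'a"]
      by (intro mat_alg_endo_conj) auto
    moreover have "\<forall>k. ?G * Y k * ?H \<in> carrier_mat n n"
      using Y by (intro allI mult_carrier_mat[of _ n n]) auto
    ultimately show ?thesis
      using diag[of "\<lambda>k. ?G * Y k * ?H"] ncpoly_eval_endo[OF Y, of "\<lambda>A. ?G * A * ?H" p] by simp
  qed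
  then show False
    using scalar_if_transvections_keep_diagonal[OF ncpoly_eval_carrier[OF Y, of p] diag[OF Y]] ns by blast
qed

text \<open>
  A renumbering of the basis moves a nonzero off-diagonal entry to the position
  \<open>(0,1)\<close>. This normalises the degree of the value to \<open>1\<close>, a generator
  of \<open>\<int>/n\<close>.
\<close>
lemma exists_value_entry_01:
  fixes p :: "'a::comm_ring_1 ncpoly"
  assumes Y: "\<forall>i. Y i \<in> carrier_mat n n" and ns: "\<nexists>c. ncpoly_eval n Y p = c \<cdot>\<^sub>m 1\<^sub>m n"
  obtains Z where "\<forall>i. Z i \<in> carrier_mat n n" "ncpoly_eval n Z p $$ (0,1) \<noteq> 0" "n \<ge> 2"
proof -
  obtain Z where Z: "\<forall>i. Z i \<in> carrier_mat n n" "\<not> diagonal_mat (ncpoly_eval n Z p)"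
    using exists_nondiagonal_value[OF Y ns] .
  then obtain i j where ij: "i < n" "j < n" "i \<noteq> j" "ncpoly_eval n Z p $$ (i,j) \<noteq> 0"
    using ncpoly_eval_carrier[OF Z(1), of p] by (auto simp: diagonal_mat_def)
  have n: "n \<ge> 2" using ij by linarith
  define \<tau> where "\<tau> = Transposition.transpose 0 i"
  define \<pi> where "\<pi> = Transposition.transpose (\<tau> 1) j \<circ> \<tau>"
  have \<tau>: "\<tau> permutes {0..<n}"
    unfolding \<tau>_def using ij n by (intro permutes_swap_id) auto
  have \<tau>1: "\<tau> 1 < n" using permutes_in_image[OF \<tau>, of 1] n by simp
  have \<pi>: "\<pi> permutes {0..<n}"
    unfolding \<pi>_def using ij \<tau>1 by (intro permutes_compose[OF \<tau>] permutes_swap_id) auto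
  have "\<tau> 0 = i" by (simp add: \<tau>_def)
  moreover have "\<tau> 0 \<noteq> \<tau> 1" using permutes_inj[OF \<tau>] by (auto dest: injD)
  ultimately have \<pi>01: "\<pi> 0 = i" "\<pi> 1 = j"
    using ij by (auto simp: \<pi>_def transpose_def)
  let ?Z = "\<lambda>k. mat n n (\<lambda>(a,b). Z k $$ (\<pi> a, \<pi> b))"
  have "ncpoly_eval n ?Z p $$ (0,1) \<noteq> 0"
    unfolding ncpoly_eval_endo[OF Z(1) mat_alg_endo_permute[OF \<pi>]] using n ij \<pi>01 by simp
  then show ?thesis using that[of ?Z] n by simp
qed

section \<open>A value that is a weighted cycle\<close>

text \<open>
  The arguments are parametrised by their entries, with the entries outside of \<open>S\<close>
  forced to be zero. The triples \<open>(k,a,b)\<close> are the coordinates in which values of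
  \<open>p\<close> are polynomial. With \<open>S\<close> always true this yields all arguments;
  with \<open>S\<close> given by degrees it yields the homogeneous ones.
\<close>
definition graded_args :: "nat \<Rightarrow> (nat \<Rightarrow> nat \<Rightarrow> nat \<Rightarrow> bool) \<Rightarrow> (nat \<times> nat \<times> nat \<Rightarrow> 'a::zero) \<Rightarrow> nat \<Rightarrow> 'a mat" where
  "graded_args n S \<sigma> k = mat n n (\<lambda>(a,b). if S k a b then \<sigma> (k,a,b) else 0)"

lemma mat_poly_on_lines_graded_args:
  "mat_poly_on_lines n (\<lambda>\<sigma> :: nat \<times> nat \<times> nat \<Rightarrow> 'a::field. ncpoly_eval n (graded_args n S \<sigma>) p)"
proof (rule mat_poly_on_lines_ncpoly_eval)
  fix k
  have "poly_on_lines (\<lambda>\<sigma> :: nat \<times> nat \<times> nat \<Rightarrow> 'a. if S k a b then \<sigma> (k,a,b) else 0)" for a b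
    by (cases "S k a b") (auto intro: poly_on_lines_coord poly_on_lines_const)
  then show "mat_poly_on_lines n (\<lambda>\<sigma> :: nat \<times> nat \<times> nat \<Rightarrow> 'a. graded_args n S \<sigma> k)"
    by (auto simp: mat_poly_on_lines_def graded_args_def)
qed

lemma graded_args_coords:
  assumes "\<forall>i. Y i \<in> carrier_mat n n" and "\<And>k a b. a < n \<Longrightarrow> b < n \<Longrightarrow> \<not> S k a b \<Longrightarrow> Y k $$ (a,b) = 0"
  shows "graded_args n S (\<lambda>(k,a,b). Y k $$ (a,b)) = Y"
proof
  fix k
  have "dim_row (Y k) = n" "dim_col (Y k) = n" using assms(1) by auto
  then show "graded_args n S (\<lambda>(k,a,b). Y k $$ (a,b)) k = Y k"
    using assms(2)[of _ _ k] by (intro eq_matI) (auto simp: graded_args_def)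
qed

text \<open>
  Homogeneous arguments of total degree \<open>1\<close> give values supported on the cycle
  \<open>a \<mapsto> a + 1\<close>. The weight at each single \<open>a\<close> can be made
  nonzero, by rotating the arguments for which the entry \<open>(0,1)\<close> is nonzero; since
  the weights are polynomial functions, all of them can be made nonzero at once.
\<close>
lemma exists_weighted_cycle_value:
  fixes p :: "'a::field ncpoly"
  assumes inf: "infinite (UNIV :: 'a set)" and p: "multilinear m p"
    and Y: "\<forall>i. Y i \<in> carrier_mat n n" and ns: "\<nexists>c. ncpoly_eval n Y p = c \<cdot>\<^sub>m 1\<^sub>m n"
  obtains Z where "\<forall>i. Z i \<in> carrier_mat n n"
    "\<And>a b. a < n \<Longrightarrow> b < n \<Longrightarrow> ncpoly_eval n Z p $$ (a,b) \<noteq> 0 \<longleftrightarrow> b = (a + 1) mod n"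
    "n \<ge> 2"
proof -
  obtain Y1 where Y1: "\<forall>i. Y1 i \<in> carrier_mat n n" "ncpoly_eval n Y1 p $$ (0,1) \<noteq> 0" and n: "n \<ge> 2"
    using exists_value_entry_01[OF Y ns] .
  have lt01: "0 < n" "1 < n" using n by auto
  obtain d Y2 where Y2: "\<forall>i. Y2 i \<in> carrier_mat n n" "\<forall>k\<in>{1..m}. cyc_graded n (d k) (Y2 k)"
    "ncpoly_eval n Y2 p $$ (0,1) \<noteq> 0"
    using exists_cyc_graded_args[OF Y1(1) p lt01 Y1(2)] .
  \<comment> \<open>Variables outside \<open>1, \<dots>, m\<close> do not occur in \<open>p\<close> and carry
    no degree condition.\<close>
  define S where "S k a b \<longleftrightarrow> (k \<in> {1..m} \<longrightarrow> b = (a + d k) mod n)" for k a b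
  have "cyc_graded n (\<Sum>k=1..m. d k) (ncpoly_eval n Y2 p)"
    by (rule cyc_graded_ncpoly_eval[OF Y2(1) p bspec[OF Y2(2)]])
  then have deg: "(\<Sum>k=1..m. d k) mod n = 1"
    using lt01 Y2(3) unfolding cyc_graded_def by fastforce
  have args: "\<forall>i. graded_args n S \<sigma> i \<in> carrier_mat n n" for \<sigma> :: "nat \<times> nat \<times> nat \<Rightarrow> 'a"
    by (simp add: graded_args_def)
  have zero: "b = (a + 1) mod n"
    if "a < n" "b < n" "ncpoly_eval n (graded_args n S \<sigma>) p $$ (a,b) \<noteq> 0" for \<sigma> a b
  proof -
    have "cyc_graded n (\<Sum>k=1..m. d k) (ncpoly_eval n (graded_args n S \<sigma>) p)"
      by (rule cyc_graded_ncpoly_eval[OF args p]) (auto simp: cyc_graded_def graded_args_def S_def split: if_splits)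
    then show ?thesis
      using that deg unfolding cyc_graded_def by (metis mod_add_right_eq)
  qed
  have "\<exists>\<sigma> :: nat \<times> nat \<times> nat \<Rightarrow> 'a. \<forall>a\<in>{0..<n}. ncpoly_eval n (graded_args n S \<sigma>) p $$ (a, (a + 1) mod n) \<noteq> 0"
  proof (rule poly_on_lines_nonzero_common[OF inf])
    fix a assume a: "a \<in> {0..<n}"
    show "poly_on_lines (\<lambda>\<sigma> :: nat \<times> nat \<times> nat \<Rightarrow> 'a. ncpoly_eval n (graded_args n S \<sigma>) p $$ (a, (a + 1) mod n))"
      using mat_poly_on_lines_graded_args[of n S p] a by (simp add: mat_poly_on_lines_def)
    \<comment> \<open>The rotation by \<open>- a\<close>, written with \<open>n - a\<close> to avoid truncated
      subtraction.\<close>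
    define \<pi> where "\<pi> x = (if x < n then (x + (n - a)) mod n else x)" for x
    have "\<pi> x = (if a \<le> x then x - a else x + n - a)" if "x < n" for x
    proof (cases "a \<le> x")
      case True
      then have "x + (n - a) = (x - a) + n" using a by simp
      then have "\<pi> x = (x - a + n) mod n" using that by (simp only: \<pi>_def if_True)
      also have "\<dots> = x - a" using that by (simp only: mod_add_self2) simp
      finally show ?thesis using True by simp
    qed (use a that in \<open>simp add: \<pi>_def\<close>)
    then have inj: "inj_on \<pi> {0..<n}"
      using a by (auto simp: inj_on_def split: if_splits)
    moreover have "\<pi> ` {0..<n} \<subseteq> {0..<n}" using n by (auto simp: \<pi>_def)
    ultimately have "\<pi> ` {0..<n} = {0..<n}" by (intro endo_inj_surj) auto
    then have \<pi>: "\<pi> permutes {0..<n}"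
      using inj by (intro bij_imp_permutes) (auto simp: bij_betw_def \<pi>_def)
    have \<pi>a: "\<pi> a = 0" "\<pi> ((a + 1) mod n) = 1"
    proof -
      show "\<pi> a = 0" using a by (simp add: \<pi>_def)
      have "\<pi> ((a + 1) mod n) = (a + 1 + (n - a)) mod n" using n by (simp add: \<pi>_def mod_simps)
      also have "a + 1 + (n - a) = 1 + n" using a by simp
      also have "(1 + n) mod n = 1" unfolding mod_add_self2 using n by simp
      finally show "\<pi> ((a + 1) mod n) = 1" .
    qed
    define W where "W k = mat n n (\<lambda>(a,b). Y2 k $$ (\<pi> a, \<pi> b))" for k
    have "ncpoly_eval n W p = mat n n (\<lambda>(a,b). ncpoly_eval n Y2 p $$ (\<pi> a, \<pi> b))"
      unfolding W_def by (rule ncpoly_eval_endo[OF Y2(1) mat_alg_endo_permute[OF \<pi>]])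
    then have "ncpoly_eval n W p $$ (a, (a + 1) mod n) \<noteq> 0"
      using a \<pi>a Y2(3) by simp
    moreover have "graded_args n S (\<lambda>(k,x,y). W k $$ (x,y)) = W"
    proof (rule graded_args_coords)
      show "\<forall>i. W i \<in> carrier_mat n n" by (simp add: W_def)
      fix k x y assume xy: "x < n" "y < n" "\<not> S k x y"
      show "W k $$ (x,y) = 0"
      proof (rule ccontr)
        assume "W k $$ (x,y) \<noteq> 0"
        then have nz: "Y2 k $$ (\<pi> x, \<pi> y) \<noteq> 0" using xy by (simp add: W_def)
        have k: "k \<in> {1..m}" "y \<noteq> (x + d k) mod n" using xy(3) by (auto simp: S_def)
        have "\<pi> x < n" "\<pi> y < n" using xy n by (auto simp: \<pi>_def)
        then have "\<pi> y = (\<pi> x + d k) mod n"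
          using bspec[OF Y2(2) k(1)] nz unfolding cyc_graded_def by blast
        also have "\<dots> = \<pi> ((x + d k) mod n)"
          using xy n by (simp add: \<pi>_def mod_simps ac_simps)
        finally have "y = (x + d k) mod n"
          using permutes_inj[OF \<pi>] by (auto dest: injD)
        then show False using k by simp
      qed
    qed
    ultimately show "\<exists>\<sigma> :: nat \<times> nat \<times> nat \<Rightarrow> 'a. ncpoly_eval n (graded_args n S \<sigma>) p $$ (a, (a + 1) mod n) \<noteq> 0"
      by metis
  qed simp
  then obtain \<sigma> :: "nat \<times> nat \<times> nat \<Rightarrow> 'a" where
    \<sigma>: "\<forall>a\<in>{0..<n}. ncpoly_eval n (graded_args n S \<sigma>) p $$ (a, (a + 1) mod n) \<noteq> 0" ..
  have "ncpoly_eval n (graded_args n S \<sigma>) p $$ (a,b) \<noteq> 0 \<longleftrightarrow> b = (a + 1) mod n"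
    if ab: "a < n" "b < n" for a b
    using zero[OF ab, of \<sigma>] bspec[OF \<sigma>, of a] ab by auto
  then show ?thesis by (rule that[OF args _ n])
qed

text \<open>
  Each step along the cycle is forced, so an entry of the power is a single product of nonzero
  weights rather than a sum that could cancel.
\<close>
lemma weighted_cycle_pow_entry:
  fixes A :: "'a::idom mat"
  assumes A: "A \<in> carrier_mat n n" and n: "n \<ge> 1"
    and cyc: "\<And>a b. a < n \<Longrightarrow> b < n \<Longrightarrow> A $$ (a,b) \<noteq> 0 \<longleftrightarrow> b = (a + 1) mod n"
    and ab: "a < n" "b < n"
  shows "(A ^\<^sub>m k) $$ (a,b) \<noteq> 0 \<longleftrightarrow> b = (a + k) mod n"
  using ab(2)
proof (induction k arbitrary: b)
  case 0
  then show ?case using A ab(1) by auto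
next
  case (Suc k)
  let ?c = "(a + k) mod n"
  have Ak: "A ^\<^sub>m k \<in> carrier_mat n n" using A by (rule pow_carrier_mat)
  have c: "?c < n" using n by simp
  have "(A ^\<^sub>m Suc k) $$ (a,b) = (\<Sum>c = 0..<n. (A ^\<^sub>m k) $$ (a,c) * A $$ (c,b))"
    using A Ak ab(1) Suc.prems by (simp add: scalar_prod_def)
  also have "\<dots> = (\<Sum>c = 0..<n. if c = ?c then (A ^\<^sub>m k) $$ (a,?c) * A $$ (?c,b) else 0)"
    using Suc.IH by (intro sum.cong) auto
  also have "\<dots> = (A ^\<^sub>m k) $$ (a,?c) * A $$ (?c,b)" using c by simp
  finally have "(A ^\<^sub>m Suc k) $$ (a,b) \<noteq> 0 \<longleftrightarrow> A $$ (?c,b) \<noteq> 0" using Suc.IH[OF c] by simp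
  also have "\<dots> \<longleftrightarrow> b = (a + Suc k) mod n" using cyc[OF c Suc.prems] by (simp add: mod_simps)
  finally show ?case .
qed

section \<open>The order of a power-central multilinear polynomial\<close>

theorem corollary1:
  fixes p :: "'a::field ncpoly" and n m \<nu> :: nat
  assumes "infinite (UNIV :: 'a set)"
    and "n \<ge> 1"
    and "multilinear m p"
    and "nu_central n \<nu> p"
    and "\<nu> > 1"
  shows "\<nu> = n"
proof -
  have scalar: "\<exists>c. ncpoly_eval n Y p ^\<^sub>m \<nu> = c \<cdot>\<^sub>m 1\<^sub>m n" if "\<forall>i. Y i \<in> carrier_mat n n" for Y
    using assms(4) that ncpoly_eval_power[OF that, of p \<nu>]
    unfolding nu_central_def central_poly_def by metis
  have minimal: "\<not> central_poly n (p ^ k)" if "1 \<le> k" "k < \<nu>" for k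
    using assms(4) that by (simp add: nu_central_def)
  obtain Y0 where Y0: "\<forall>i. Y0 i \<in> carrier_mat n n" "ncpoly_eval n Y0 (p ^ \<nu>) \<noteq> 0\<^sub>m n n"
    using assms(4) by (auto simp: nu_central_def central_poly_def)
  have "ncpoly_eval n Y0 p \<noteq> 0\<^sub>m n n"
  proof
    assume "ncpoly_eval n Y0 p = 0\<^sub>m n n"
    then have "ncpoly_eval n Y0 (p ^ \<nu>) = 0\<^sub>m n n"
      using assms(5) ncpoly_eval_power[OF Y0(1), of p \<nu>]
        right_mult_zero_mat[OF pow_carrier_mat[of "0\<^sub>m n n :: 'a mat" n "\<nu> - 1"]]
      by (cases \<nu>) auto
    with Y0(2) show False by simp
  qed
  moreover have "\<not> central_poly n p" using minimal[of 1] assms(5) by simp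
  ultimately obtain Y where Y: "\<forall>i. Y i \<in> carrier_mat n n" "\<nexists>c. ncpoly_eval n Y p = c \<cdot>\<^sub>m 1\<^sub>m n"
    using Y0(1) unfolding central_poly_def by blast
  obtain Z where Z: "\<forall>i. Z i \<in> carrier_mat n n" and n2: "n \<ge> 2"
    and cyc: "\<And>a b. a < n \<Longrightarrow> b < n \<Longrightarrow> ncpoly_eval n Z p $$ (a,b) \<noteq> 0 \<longleftrightarrow> b = (a + 1) mod n"
    using exists_weighted_cycle_value[OF assms(1,3) Y] by metis
  define A where "A = ncpoly_eval n Z p"
  have A: "A \<in> carrier_mat n n" unfolding A_def by (rule ncpoly_eval_carrier[OF Z])
  note Apow = weighted_cycle_pow_entry[OF A assms(2) cyc[folded A_def]]
  obtain c where c: "A ^\<^sub>m \<nu> = c \<cdot>\<^sub>m 1\<^sub>m n" using scalar[OF Z] by (auto simp: A_def)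
  have "\<nu> mod n = 0"
  proof (rule ccontr)
    assume "\<nu> mod n \<noteq> 0"
    then show False using Apow[of 0 "\<nu> mod n" \<nu>] c n2 by simp
  qed
  then have "n \<le> \<nu>" using assms(5) by (intro dvd_imp_le) auto
  have c0: "(A ^\<^sub>m \<nu>) $$ (0,0) \<noteq> 0" using Apow[of 0 0 \<nu>] \<open>\<nu> mod n = 0\<close> n2 by simp

  \<comment> \<open>All values of \<open>p\<close> as one family of matrices whose entries are polynomial
    functions of the parameter \<open>\<sigma>\<close>.\<close>
  define P where "P \<sigma> = ncpoly_eval n (graded_args n (\<lambda>_ _ _. True) \<sigma>) p" for \<sigma> :: "nat \<times> nat \<times> nat \<Rightarrow> 'a"
  define s where "s \<sigma> = (P \<sigma> ^\<^sub>m \<nu>) $$ (0,0)" for \<sigma>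
  have all: "ncpoly_eval n Y p = P (\<lambda>(k,a,b). Y k $$ (a,b))" if "\<forall>i. Y i \<in> carrier_mat n n" for Y
    using graded_args_coords[OF that, of "\<lambda>_ _ _. True"] by (simp add: P_def)
  have args: "\<forall>i. graded_args n (\<lambda>_ _ _. True) \<sigma> i \<in> carrier_mat n n" for \<sigma> :: "nat \<times> nat \<times> nat \<Rightarrow> 'a"
    by (simp add: graded_args_def)
  have PC: "P \<sigma> \<in> carrier_mat n n" for \<sigma> unfolding P_def by (rule ncpoly_eval_carrier[OF args])
  have Ps: "P \<sigma> ^\<^sub>m \<nu> = s \<sigma> \<cdot>\<^sub>m 1\<^sub>m n" for \<sigma>
  proof -
    obtain e where e: "P \<sigma> ^\<^sub>m \<nu> = e \<cdot>\<^sub>m 1\<^sub>m n" using scalar[OF args] by (auto simp: P_def)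
    then show ?thesis using assms(2) by (simp add: s_def)
  qed
  have Pl: "mat_poly_on_lines n P"
    unfolding P_def by (rule mat_poly_on_lines_graded_args)
  have sl: "poly_on_lines s"
    using mat_poly_on_lines_pow[OF Pl, of \<nu>] assms(2) unfolding s_def[abs_def] mat_poly_on_lines_def by simp
  define \<zeta> where "\<zeta> = (\<lambda>(k,a,b). Z k $$ (a,b))"
  have \<zeta>: "P \<zeta> = A" using all[OF Z] by (simp add: A_def \<zeta>_def)
  have s\<zeta>: "s \<zeta> \<noteq> 0" using c0 by (simp add: s_def \<zeta>)
  have mid: "coeff (char_poly (P \<sigma>)) j = 0" if j: "0 < j" "j < n" for \<sigma> j
  proof -
    define \<alpha> where "\<alpha> \<sigma> = coeff (char_poly (P \<sigma>)) j" for \<sigma>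
    have \<alpha>l: "poly_on_lines \<alpha>" unfolding \<alpha>_def by (rule poly_on_lines_coeff_char_poly[OF Pl])
    have \<alpha>\<zeta>: "\<alpha> \<zeta> = 0"
      unfolding \<alpha>_def \<zeta> using cyc[folded A_def] by (intro char_poly_middle_coeff_cyclic[OF A _ j]) auto
    obtain F where F: "finite F" "\<And>\<sigma>. \<exists>v\<in>F. \<alpha> \<sigma> ^ \<nu> * s \<sigma> ^ j = v * s \<sigma> ^ n"
      using char_poly_coeff_of_scalar_pow[of \<nu> n j, where 'a = 'a] assms(2,5) j(1) PC Ps
      unfolding \<alpha>_def by (metis less_imp_le)
    \<comment> \<open>At each \<open>\<sigma>\<close> one of the finitely many differences vanishes. If none
      vanished identically, they would have a common nonzero point.\<close>
    have "\<exists>v\<in>F. \<forall>\<sigma>. \<alpha> \<sigma> ^ \<nu> * s \<sigma> ^ j - v * s \<sigma> ^ n = 0"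
    proof (rule ccontr)
      assume contr: "\<not> ?thesis"
      have "\<exists>\<sigma>. \<forall>v\<in>F. \<alpha> \<sigma> ^ \<nu> * s \<sigma> ^ j + (- v) * s \<sigma> ^ n \<noteq> 0"
        using contr
        by (intro poly_on_lines_nonzero_common[OF assms(1) F(1)] poly_on_lines_add poly_on_lines_mult
            poly_on_lines_power poly_on_lines_const \<alpha>l sl) auto
      then show False using F(2) by fastforce
    qed
    then obtain v where v: "\<And>\<sigma>. \<alpha> \<sigma> ^ \<nu> * s \<sigma> ^ j = v * s \<sigma> ^ n" by auto
    have "v = 0" using v[of \<zeta>] \<alpha>\<zeta> s\<zeta> assms(5) by (simp add: power_0_left)
    then have prod: "\<alpha> \<sigma> = 0 \<or> s \<sigma> = 0" for \<sigma> using v[of \<sigma>] by auto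
    have "\<alpha> \<sigma> = 0"
      using poly_on_lines_nonzero_common_pair[OF assms(1) \<alpha>l _ sl s\<zeta>, of \<sigma>] prod by blast
    then show ?thesis by (simp add: \<alpha>_def)
  qed
  have Pn: "P \<sigma> ^\<^sub>m n = (- coeff (char_poly (P \<sigma>)) 0) \<cdot>\<^sub>m 1\<^sub>m n" for \<sigma>
    using pow_eq_scalar_of_char_poly[OF PC assms(2) mid] .
  have "central_poly n (p ^ n)"
    unfolding central_poly_def
  proof (intro conjI allI impI)
    fix Y :: "nat \<Rightarrow> 'a mat" assume Y: "\<forall>i. Y i \<in> carrier_mat n n"
    show "\<exists>c. ncpoly_eval n Y (p ^ n) = c \<cdot>\<^sub>m 1\<^sub>m n"
      unfolding ncpoly_eval_power[OF Y] all[OF Y] using Pn by blast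
  next
    have "(A ^\<^sub>m n) $$ (0,0) \<noteq> 0" using Apow[of 0 0 n] n2 by simp
    then have "ncpoly_eval n Z (p ^ n) \<noteq> 0\<^sub>m n n"
      unfolding ncpoly_eval_power[OF Z] A_def using n2 by auto
    then show "\<exists>Y. (\<forall>i. Y i \<in> carrier_mat n n) \<and> ncpoly_eval n Y (p ^ n) \<noteq> 0\<^sub>m n n"
      using Z by blast
  qed
  then have "\<not> n < \<nu>" using minimal[OF assms(2)] by blast
  with \<open>n \<le> \<nu>\<close> show ?thesis by simp
qed

end
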